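(* Let $p$ be an odd rational prime, let $\zeta_p$ be a primitive $p$-th root of unity, and let $(1-\zeta_p)$ be the unique prime of $\mathbb{Z}[\zeta_p]$ above $p$. Let $\alpha\in\mathbb{Z}[\zeta_p]$ and suppose that $x^p-\alpha$ is irreducible in $\mathbb{Z}[\zeta_p][x]$. Let $\sqrt[p]{\alpha}$ be a root of $x^p-\alpha$. Then the ring of integers of $\mathbb{Q}(\zeta_p,\sqrt[p]{\alpha})$ is $\mathbb{Z}[\zeta_p][\sqrt[p]{\alpha}]$ if and only if $\alpha$ is square-free as an ideal of $\mathbb{Z}[\zeta_p]$ and the congruence $$\alpha^p\equiv\alpha \pmod{(1-\zeta_p)^2}$$ is not satisfied.
   Context: "$\alpha$ is square-free as an ideal" means that the principal ideal $(\alpha)$ is not divisible by the square of any prime ideal; the unit ideal counts as square-free. *)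

theory Defs
  imports
    Complex_Main
    "HOL-Computational_Algebra.Computational_Algebra"
    "HOL-Algebra.Ideal_Product"
    "HOL-Algebra.Generated_Fields"
    "HOL-Algebra.Algebraic_Closure_Type"
begin

definition primitive_root_of_unity :: "nat \<Rightarrow> 'a::field \<Rightarrow> bool" where
  "primitive_root_of_unity n z \<longleftrightarrow>
     n > 0 \<and> z ^ n = 1 \<and> (\<forall>k. 0 < k \<and> k < n \<longrightarrow> z ^ k \<noteq> 1)"

text \<open>Subrings of a type-class ring are represented by their carrier sets;
  \<open>subring_on S\<close> turns such a set into a ring structure, so that the ideal-theoretic and
  divisibility notions of HOL-Algebra are relative to \<open>S\<close> and not to the whole type.\<close>

definition subring_on :: "'a::comm_ring_1 set \<Rightarrow> 'a ring" where
  "subring_on S = ring_of_type_algebra\<lparr>carrier := S\<rparr>"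

text \<open>The polynomial ring $S[x]$ inside the polynomials over the ambient type.\<close>

definition polys_over :: "'a::comm_ring_1 set \<Rightarrow> 'a poly set" where
  "polys_over S = {f. \<forall>i. coeff f i \<in> S}"

text \<open>The ring $S[a]$, for a subring $S$ of the ambient ring.\<close>

definition ring_adjoin :: "'a::comm_ring_1 set \<Rightarrow> 'a \<Rightarrow> 'a set" where
  "ring_adjoin S a = {poly f a | f. f \<in> polys_over S}"

text \<open>\<open>generate_field\<close> yields the smallest subfield containing the given set. The prime field of
  the complex numbers is $\mathbf{Q}$, so this is $\mathbf{Q}(A)$.\<close>

definition rat_adjoin :: "complex set \<Rightarrow> complex set" where
  "rat_adjoin A = generate_field ring_of_type_algebra A"

definition ring_of_integers :: "complex set \<Rightarrow> complex set" where
  "ring_of_integers K = {x \<in> K. algebraic_int x}"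

definition ideal_dvd :: "'a ring \<Rightarrow> 'a set \<Rightarrow> 'a set \<Rightarrow> bool" where
  "ideal_dvd R I J \<longleftrightarrow> (\<exists>L. ideal L R \<and> J = I \<cdot>\<^bsub>R\<^esub> L)"

definition squarefree_ideal :: "'a ring \<Rightarrow> 'a set \<Rightarrow> bool" where
  "squarefree_ideal R I \<longleftrightarrow> \<not> (\<exists>P. primeideal P R \<and> ideal_dvd R (P \<cdot>\<^bsub>R\<^esub> P) I)"

definition cong_mod_ideal :: "'a::comm_ring_1 \<Rightarrow> 'a \<Rightarrow> 'a set \<Rightarrow> bool" where
  "cong_mod_ideal a b I \<longleftrightarrow> a - b \<in> I"

abbreviation cyclotomic_ring :: "complex \<Rightarrow> complex set" where
  "cyclotomic_ring \<zeta> \<equiv> ring_adjoin \<int> \<zeta>"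

end

theory Submission
  imports Defs "Jordan_Normal_Form.Char_Poly" "HOL-Number_Theory.Cong"
begin

text \<open>Write \<open>R = \<int>[\<zeta>]\<close>, \<open>K = \<rat>(\<zeta>)\<close> and \<open>\<pi> = 1 - \<zeta>\<close>; then \<open>p\<close> is a unit times \<open>\<pi>\<^sup>p\<^sup>-\<^sup>1\<close>, and \<open>R\<close> is integrally
  closed with finite quotients. As \<open>\<beta>\<close> lies outside \<open>K\<close>, the powers \<open>\<beta>\<^sup>i\<close> with \<open>i < p\<close> are
  linearly independent over \<open>K\<close>, so integral elements outside \<open>R[\<beta>]\<close> are recognised by their
  coefficients.

  If \<open>(\<alpha>) = P\<^sup>2 L\<close>, some product \<open>j = b l\<close> with \<open>b \<in> P\<close> and \<open>l \<in> L\<close> is not divisible by \<open>\<alpha>\<close>, although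
  \<open>\<alpha>\<close> divides \<open>j\<^sup>2\<close>; then \<open>(j / \<alpha>) \<beta>\<^sup>p\<^sup>-\<^sup>1\<close> is integral. If \<open>\<pi>\<^sup>2\<close> divides \<open>\<alpha>\<^sup>p - \<alpha>\<close>, then \<open>\<pi>\<^sup>2\<close> divides
  \<open>(\<beta> - \<alpha>)\<^sup>p\<close> and \<open>(\<beta> - \<alpha>)\<^sup>p\<^sup>-\<^sup>1 / \<pi>\<close> is integral.

  Conversely let \<open>\<gamma> = \<Sum> c\<^sub>i \<beta>\<^sup>i\<close> be integral. Averaging the conjugates of \<open>\<gamma>\<close> against powers of \<open>\<zeta>\<close> shows
  that \<open>p c\<^sub>i \<beta>\<^sup>i\<close> is integral, hence \<open>(p c\<^sub>i)\<^sup>p \<alpha>\<^sup>i \<in> R\<close>, and \<open>p c\<^sub>i \<in> R\<close> because \<open>\<alpha>\<close> is square-free. It remains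
  to remove powers of \<open>\<pi>\<close>, which is the Eisenstein argument for \<open>\<beta> - \<alpha>\<close>, whose norm \<open>\<alpha> - \<alpha>\<^sup>p\<close> is exactly
  divisible by \<open>\<pi>\<close>.\<close>

section \<open>Subrings of a commutative ring\<close>

text \<open>Closure under subtraction together with 1 yields zero, negatives and sums. Keeping the
  subring as a bare set lets all arithmetic stay in the ambient type.\<close>

locale subring_set =
  fixes S :: "'a::comm_ring_1 set"
  assumes one_mem: "1 \<in> S"
    and diff_mem: "x \<in> S \<Longrightarrow> y \<in> S \<Longrightarrow> x - y \<in> S"
    and mult_mem: "x \<in> S \<Longrightarrow> y \<in> S \<Longrightarrow> x * y \<in> S"
begin

lemma zero_mem: "0 \<in> S"
  using diff_mem[OF one_mem one_mem] by simp

lemma minus_mem: "x \<in> S \<Longrightarrow> - x \<in> S"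
  using diff_mem[OF zero_mem, of x] by simp

lemma add_mem: "x \<in> S \<Longrightarrow> y \<in> S \<Longrightarrow> x + y \<in> S"
  using diff_mem[OF _ minus_mem, of x y] by simp

lemma power_mem: "x \<in> S \<Longrightarrow> x ^ n \<in> S"
  by (induction n) (auto intro: one_mem mult_mem)

lemma sum_mem: "(\<And>i. i \<in> I \<Longrightarrow> f i \<in> S) \<Longrightarrow> sum f I \<in> S"
  by (induction I rule: infinite_finite_induct) (auto intro: zero_mem add_mem)

lemma prod_mem: "(\<And>i. i \<in> I \<Longrightarrow> f i \<in> S) \<Longrightarrow> prod f I \<in> S"
  by (induction I rule: infinite_finite_induct) (auto intro: one_mem mult_mem)

lemma of_nat_mem: "of_nat n \<in> S"
  by (induction n) (auto intro: zero_mem one_mem add_mem)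

lemma of_int_mem: "of_int n \<in> S"
  by (cases n) (auto intro: of_nat_mem minus_mem simp del: of_nat_Suc)

lemma Ints_subset: "\<int> \<subseteq> S"
  by (auto elim!: Ints_cases intro: of_int_mem)

lemmas mem_intros = zero_mem one_mem minus_mem add_mem diff_mem mult_mem power_mem sum_mem
  prod_mem of_nat_mem of_int_mem

section \<open>Polynomials over a subring and the ring \<open>S[a]\<close>\<close>

lemma poly_mem:
  assumes "f \<in> polys_over S" "a \<in> S" shows "poly f a \<in> S"
  using assms by (auto simp: poly_altdef polys_over_def intro!: mem_intros)

lemma subring_set_polys_over: "subring_set (polys_over S)"
  by unfold_locales
    (auto simp: polys_over_def coeff_mult one_pCons coeff_pCons split: nat.splits intro!: mem_intros)

lemma pCons_mem: "c \<in> S \<Longrightarrow> f \<in> polys_over S \<Longrightarrow> pCons c f \<in> polys_over S"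
  by (auto simp: polys_over_def coeff_pCons split: nat.splits)

lemma const_mem: "c \<in> S \<Longrightarrow> [:c:] \<in> polys_over S"
  by (rule pCons_mem) (auto simp: polys_over_def zero_mem)

lemma X_mem: "[:0, 1:] \<in> polys_over S"
  by (intro pCons_mem const_mem zero_mem one_mem)

lemma monom_mem: "c \<in> S \<Longrightarrow> Polynomial.monom c n \<in> polys_over S"
  by (auto simp: polys_over_def zero_mem)

lemma smult_mem: "c \<in> S \<Longrightarrow> f \<in> polys_over S \<Longrightarrow> Polynomial.smult c f \<in> polys_over S"
  by (auto simp: polys_over_def mult_mem)

lemma pcompose_mem: "f \<in> polys_over S \<Longrightarrow> g \<in> polys_over S \<Longrightarrow> pcompose f g \<in> polys_over S"
  unfolding polys_over_def mem_Collect_eq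
  by (intro allI coeff_pcompose_semiring_closed) (simp_all add: zero_mem add_mem mult_mem)

lemma base_subset_ring_adjoin: "S \<subseteq> ring_adjoin S a"
  unfolding ring_adjoin_def
proof
  fix c assume "c \<in> S"
  then show "c \<in> {poly f a |f. f \<in> polys_over S}"
    by (intro CollectI exI[of _ "[:c:]"]) (auto intro: const_mem)
qed

lemma gen_mem_ring_adjoin: "a \<in> ring_adjoin S a"
  unfolding ring_adjoin_def by (intro CollectI exI[of _ "[:0, 1:]"]) (auto intro: X_mem)

lemma subring_set_ring_adjoin: "subring_set (ring_adjoin S a)"
proof -
  interpret P: subring_set "polys_over S" by (rule subring_set_polys_over)
  show ?thesis
  proof
    show "1 \<in> ring_adjoin S a"
      using base_subset_ring_adjoin one_mem by blast
  next
    fix x y assume "x \<in> ring_adjoin S a" "y \<in> ring_adjoin S a"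
    then obtain f g where fg: "f \<in> polys_over S" "g \<in> polys_over S" "x = poly f a" "y = poly g a"
      by (auto simp: ring_adjoin_def)
    show "x - y \<in> ring_adjoin S a"
      unfolding ring_adjoin_def using fg
      by (intro CollectI exI[of _ "f - g"]) (auto intro: P.diff_mem)
    show "x * y \<in> ring_adjoin S a"
      unfolding ring_adjoin_def using fg
      by (intro CollectI exI[of _ "f * g"]) (auto intro: P.mult_mem)
  qed
qed

text \<open>Since the leading coefficient is 1, long division never divides by a scalar, so quotient
  and remainder keep their coefficients in \<open>S\<close>.\<close>

lemma division_by_monic:
  assumes m: "m \<in> polys_over S" "lead_coeff m = 1" "Polynomial.degree m > 0"
    and f: "f \<in> polys_over S"
  obtains q r where "q \<in> polys_over S" "r \<in> polys_over S" "f = q * m + r"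
    "Polynomial.degree r < Polynomial.degree m"
proof -
  interpret P: subring_set "polys_over S" by (rule subring_set_polys_over)
  have "\<exists>q r. q \<in> polys_over S \<and> r \<in> polys_over S \<and> f = q * m + r \<and>
    Polynomial.degree r < Polynomial.degree m"
    using f
  proof (induction "Polynomial.degree f" arbitrary: f rule: less_induct)
    case less
    show ?case
    proof (cases "Polynomial.degree f < Polynomial.degree m")
      case True
      with less.prems show ?thesis
        by (intro exI[of _ 0] exI[of _ f]) (auto intro: P.zero_mem)
    next
      case False
      define t where "t = Polynomial.monom (lead_coeff f) (Polynomial.degree f - Polynomial.degree m)"
      have t: "t \<in> polys_over S"
        unfolding t_def using less.prems by (intro monom_mem) (auto simp: polys_over_def)
      have "Polynomial.degree (f - t * m) < Polynomial.degree f"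
      proof (rule degree_lessI)
        show "f - t * m \<noteq> 0 \<or> Polynomial.degree f > 0" using False m by auto
        show "\<forall>k\<ge>Polynomial.degree f. coeff (f - t * m) k = 0"
        proof (intro allI impI)
          fix k assume k: "Polynomial.degree f \<le> k"
          have "coeff (t * m) k = (if k < Polynomial.degree f - Polynomial.degree m then 0 else
            lead_coeff f * coeff m (k - (Polynomial.degree f - Polynomial.degree m)))"
            unfolding t_def by (simp add: coeff_monom_mult)
          also have "\<dots> = (if k = Polynomial.degree f then lead_coeff f else 0)"
            using k False m by (auto simp: coeff_eq_0)
          finally show "coeff (f - t * m) k = 0"
            using k by (auto simp: coeff_eq_0)
        qed
      qed
      moreover have "f - t * m \<in> polys_over S"
        using less.prems t m by (intro P.diff_mem P.mult_mem)
      ultimately obtain q r where qr: "q \<in> polys_over S" "r \<in> polys_over S" "f - t * m = q * m + r"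
        "Polynomial.degree r < Polynomial.degree m"
        using less.hyps[of "f - t * m"] by blast
      then have "f = (q + t) * m + r" by (simp add: algebra_simps)
      with qr t show ?thesis by (metis P.add_mem)
    qed
  qed
  with that show ?thesis by blast
qed

lemma ring_adjoin_reduced:
  assumes m: "m \<in> polys_over S" "lead_coeff m = 1" "Polynomial.degree m > 0" "poly m a = 0"
    and x: "x \<in> ring_adjoin S a"
  obtains r where "r \<in> polys_over S" "Polynomial.degree r < Polynomial.degree m" "x = poly r a"
proof -
  from x obtain f where f: "f \<in> polys_over S" "x = poly f a" by (auto simp: ring_adjoin_def)
  from division_by_monic[OF m(1-3) f(1)] obtain q r where
    "q \<in> polys_over S" "r \<in> polys_over S" "f = q * m + r" "Polynomial.degree r < Polynomial.degree m" .
  with m f that show ?thesis by auto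
qed

end

lemma ring_adjoin_subset:
  assumes "subring_set T" "S \<subseteq> T" "a \<in> T" shows "ring_adjoin S a \<subseteq> T"
proof -
  interpret subring_set T by fact
  have "polys_over S \<subseteq> polys_over T" using assms by (auto simp: polys_over_def)
  with assms show ?thesis by (auto simp: ring_adjoin_def intro!: poly_mem)
qed

interpretation Ints: subring_set "\<int> :: 'a::comm_ring_1 set"
  by unfold_locales auto

interpretation Rats: subring_set "\<rat> :: 'a::field_char_0 set"
  by unfold_locales auto

text \<open>The middle binomial coefficients are multiples of \<open>p\<close> with natural
  quotients, so the error term, divided by \<open>p\<close>, stays in \<open>S\<close>.\<close>

lemma (in subring_set) freshmans_dream:
  assumes p: "Factorial_Ring.prime p" and "x \<in> S" "y \<in> S"
  shows "\<exists>w\<in>S. (x + y) ^ p = x ^ p + y ^ p + of_nat p * w"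
proof
  define w where "w = (\<Sum>k\<in>{1..<p}. of_nat ((p choose k) div p) * x ^ k * y ^ (p - k))"
  show "w \<in> S" unfolding w_def using assms by (intro mem_intros)
  have p0: "p > 0" using p prime_gt_0_nat by blast
  have "(x + y) ^ p = (\<Sum>k<Suc p. of_nat (p choose k) * x ^ k * y ^ (p - k))"
    by (simp add: binomial_ring lessThan_Suc_atMost)
  also have "\<dots> = y ^ p + (\<Sum>k\<in>{1..<p}. of_nat (p choose k) * x ^ k * y ^ (p - k)) + x ^ p"
    using p0 by (simp add: sum.atLeast_Suc_lessThan atLeast0LessThan[symmetric])
  also have "(\<Sum>k\<in>{1..<p}. of_nat (p choose k) * x ^ k * y ^ (p - k)) = of_nat p * w"
    unfolding w_def sum_distrib_left
  proof (intro sum.cong refl)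
    fix k assume "k \<in> {1..<p}"
    then have "p dvd (p choose k)" using p by (intro dvd_choose_prime) auto
    then have "(of_nat (p choose k) :: 'a) = of_nat p * of_nat ((p choose k) div p)"
      by (metis dvd_mult_div_cancel of_nat_mult)
    then show "of_nat (p choose k) * x ^ k * y ^ (p - k) =
      of_nat p * (of_nat ((p choose k) div p) * x ^ k * y ^ (p - k))" by (simp add: mult.assoc)
  qed
  finally show "(x + y) ^ p = x ^ p + y ^ p + of_nat p * w" by (simp add: add_ac)
qed

lemma monic_prod_linear:
  fixes f :: "'i \<Rightarrow> 'a::idom"
  assumes "finite A"
  shows "Polynomial.degree (\<Prod>a\<in>A. [:- f a, 1:]) = card A \<and> lead_coeff (\<Prod>a\<in>A. [:- f a, 1:]) = 1"
  using assms
proof (induction A rule: finite_induct)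
  case (insert a A)
  have "(\<Prod>a\<in>A. [:- f a, 1:]) \<noteq> 0" using insert.hyps by (simp add: prod_zero_iff)
  then have "Polynomial.degree ([:- f a, 1:] * (\<Prod>a\<in>A. [:- f a, 1:])) = Suc (card A)"
    using insert by (subst degree_mult_eq) auto
  moreover have "lead_coeff ([:- f a, 1:] * (\<Prod>a\<in>A. [:- f a, 1:])) = 1"
    using insert by (subst lead_coeff_mult) auto
  ultimately show ?case
    unfolding prod.insert[OF insert.hyps] card_insert_disjoint[OF insert.hyps] by blast
qed simp

lemma poly_eq_sum_lessThan:
  fixes x :: "'a::comm_ring_1"
  assumes "Polynomial.degree g < n"
  shows "poly g x = (\<Sum>i<n. coeff g i * x ^ i)"
proof -
  have "poly g x = (\<Sum>i\<le>Polynomial.degree g. coeff g i * x ^ i)" by (rule poly_altdef)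
  also have "\<dots> = (\<Sum>i<n. coeff g i * x ^ i)"
    using assms by (intro sum.mono_neutral_left) (auto simp: coeff_eq_0 not_le)
  finally show ?thesis .
qed

section \<open>Algebraic integers\<close>

text \<open>For finite \<open>I\<close> this is the finitely generated abelian group on which
  integrality is tested by the determinant trick.\<close>

definition int_span :: "'i set \<Rightarrow> ('i \<Rightarrow> 'a::comm_ring_1) \<Rightarrow> 'a set" where
  "int_span I g = {\<Sum>i\<in>I. of_int (m i) * g i | m. True}"

lemma int_span_add: "x \<in> int_span I g \<Longrightarrow> y \<in> int_span I g \<Longrightarrow> x + y \<in> int_span I g"
proof -
  assume "x \<in> int_span I g" "y \<in> int_span I g"
  then obtain m n where "x = (\<Sum>i\<in>I. of_int (m i) * g i)" "y = (\<Sum>i\<in>I. of_int (n i) * g i)"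
    by (auto simp: int_span_def)
  then have "x + y = (\<Sum>i\<in>I. of_int (m i + n i) * g i)"
    by (simp add: sum.distrib algebra_simps)
  then show ?thesis unfolding int_span_def by (intro CollectI exI[of _ "\<lambda>i. m i + n i"]) simp
qed

lemma int_span_scale: "x \<in> int_span I g \<Longrightarrow> of_int k * x \<in> int_span I g"
proof -
  assume "x \<in> int_span I g"
  then obtain m where "x = (\<Sum>i\<in>I. of_int (m i) * g i)" by (auto simp: int_span_def)
  then have "of_int k * x = (\<Sum>i\<in>I. of_int (k * m i) * g i)"
    by (simp add: sum_distrib_left algebra_simps)
  then show ?thesis unfolding int_span_def by (intro CollectI exI[of _ "\<lambda>i. k * m i"]) simp
qed

lemma int_span_gen: 
  assumes "finite I" "i \<in> I" shows "g i \<in> int_span I g"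
proof -
  have "g i = (\<Sum>j\<in>I. of_int (if j = i then 1 else 0) * g j)"
    using assms by (simp add: if_distrib[of "\<lambda>c. of_int c * _"] cong: if_cong)
  then show ?thesis
    unfolding int_span_def by (intro CollectI exI[of _ "\<lambda>j. if j = i then 1 else 0"]) simp
qed

lemma int_span_0: "0 \<in> int_span I g"
  unfolding int_span_def by (intro CollectI exI[of _ "\<lambda>_. 0"]) simp

lemma int_span_sum: "(\<And>j. j \<in> J \<Longrightarrow> f j \<in> int_span I g) \<Longrightarrow> sum f J \<in> int_span I g"
  by (induction J rule: infinite_finite_induct) (auto intro: int_span_0 int_span_add)

lemma int_span_mult_mem:
  assumes "\<And>i. i \<in> I \<Longrightarrow> x * g i \<in> int_span I g" and y: "y \<in> int_span I g"
  shows "x * y \<in> int_span I g"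
proof -
  from y obtain m where "y = (\<Sum>i\<in>I. of_int (m i) * g i)" by (auto simp: int_span_def)
  then have "x * y = (\<Sum>i\<in>I. of_int (m i) * (x * g i))"
    by (simp add: sum_distrib_left algebra_simps)
  then show ?thesis using assms by (auto intro!: int_span_sum int_span_scale)
qed

text \<open>The vector \<open>g\<close> is an eigenvector, with eigenvalue \<open>x\<close>, of the integer matrix that
  describes multiplication by \<open>x\<close>.\<close>

lemma algebraic_int_if_stable_nat:
  fixes x :: "'a::field_char_0" and g :: "nat \<Rightarrow> 'a"
  assumes nz: "\<exists>i<n. g i \<noteq> 0"
    and stable: "\<And>i. i < n \<Longrightarrow> x * g i \<in> int_span {..<n} g"
  shows "algebraic_int x"
proof -
  have "\<exists>m. \<forall>i<n. x * g i = (\<Sum>j<n. of_int (m i j) * g j)"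
    using stable by (simp add: int_span_def) metis
  then obtain m where m: "\<And>i. i < n \<Longrightarrow> x * g i = (\<Sum>j<n. of_int (m i j) * g j)" by blast
  define A :: "int mat" where "A = mat n n (\<lambda>(i, j). m i j)"
  have A: "A \<in> carrier_mat n n" by (simp add: A_def)
  let ?B = "map_mat (of_int :: int \<Rightarrow> 'a) A"
  have B: "?B \<in> carrier_mat n n" using A by simp
  have "eigenvector ?B (vec n g) x"
    unfolding eigenvector_def
  proof (intro conjI)
    show "vec n g \<in> carrier_vec (dim_row ?B)" using A by simp
    show "vec n g \<noteq> 0\<^sub>v (dim_row ?B)"
      using nz A by (auto simp: vec_eq_iff)
    show "?B *\<^sub>v vec n g = x \<cdot>\<^sub>v vec n g"
      using A m by (intro eq_vecI) (auto simp: A_def scalar_prod_def atLeast0LessThan)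
  qed
  then have "eigenvalue ?B x" by (auto simp: eigenvalue_def)
  then have "poly (char_poly ?B) x = 0" using eigenvalue_root_char_poly[OF B] by simp
  then have "poly (map_poly of_int (char_poly A)) x = 0"
    by (simp add: of_int_hom.char_poly_hom[OF A])
  moreover have "lead_coeff (char_poly A) = 1" using degree_monic_char_poly[OF A] by simp
  ultimately show ?thesis by (auto simp: algebraic_int_altdef_ipoly)
qed

text \<open>Enumerating \<open>I\<close> reduces the claim to the index set of a matrix. The freedom
  in \<open>I\<close> allows products and sums of index sets later.\<close>

lemma algebraic_int_if_stable:
  fixes x :: "'a::field_char_0"
  assumes fin: "finite I" and nz: "\<exists>i\<in>I. g i \<noteq> 0"
    and stable: "\<And>i. i \<in> I \<Longrightarrow> x * g i \<in> int_span I g"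
  shows "algebraic_int x"
proof -
  obtain e where e: "bij_betw e {..<card I} I"
    using ex_bij_betw_nat_finite[OF fin] by (auto simp: atLeast0LessThan)
  have span: "int_span I g \<subseteq> int_span {..<card I} (g \<circ> e)"
  proof
    fix y assume "y \<in> int_span I g"
    then obtain m where "y = (\<Sum>i\<in>I. of_int (m i) * g i)" by (auto simp: int_span_def)
    then have "y = (\<Sum>i<card I. of_int ((m \<circ> e) i) * (g \<circ> e) i)"
      by (simp add: sum.reindex_bij_betw[OF e, of "\<lambda>i. of_int (m i) * g i"])
    then show "y \<in> int_span {..<card I} (g \<circ> e)"
      unfolding int_span_def by blast
  qed
  show ?thesis
  proof (rule algebraic_int_if_stable_nat)
    show "\<exists>i<card I. (g \<circ> e) i \<noteq> 0"
    proof -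
      from nz obtain i where "i \<in> I" "g i \<noteq> 0" by blast
      moreover from this e obtain k where "k < card I" "i = e k"
        unfolding bij_betw_def by blast
      ultimately show ?thesis by auto
    qed
    show "x * (g \<circ> e) i \<in> int_span {..<card I} (g \<circ> e)" if "i < card I" for i
      using that e span stable by (auto simp: bij_betw_def)
  qed
qed

lemma algebraic_int_power_mem_span:
  assumes "algebraic_int (x :: 'a::field_char_0)"
  obtains n where "n > 0" "x ^ n \<in> int_span {..<n} (\<lambda>i. x ^ i)"
proof -
  from assms obtain q where q: "poly (map_poly of_int q) x = 0" "lead_coeff q = (1::int)"
    by (auto simp: algebraic_int_altdef_ipoly)
  define n where "n = Polynomial.degree q"
  have deg: "Polynomial.degree (map_poly of_int q :: 'a poly) = n" by (simp add: n_def)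
  have "n > 0"
  proof (rule ccontr)
    assume "\<not> n > 0"
    then have "q = [:1:]" using q by (metis degree_eq_zeroE gr0I lead_coeff_pCons(2) n_def)
    with q show False by simp
  qed
  have "0 = (\<Sum>i\<le>n. of_int (coeff q i) * x ^ i)"
    using q deg by (simp add: poly_altdef)
  also have "\<dots> = (\<Sum>i<n. of_int (coeff q i) * x ^ i) + x ^ n"
    using q by (simp add: n_def flip: lessThan_Suc_atMost)
  finally have "x ^ n = (\<Sum>i<n. of_int (- coeff q i) * x ^ i)"
    by (simp add: sum_negf eq_neg_iff_add_eq_0 add.commute)
  then have "x ^ n \<in> int_span {..<n} (\<lambda>i. x ^ i)"
    unfolding int_span_def by (intro CollectI exI[of _ "\<lambda>i. - coeff q i"]) auto
  with \<open>n > 0\<close> that show ?thesis by blast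
qed

text \<open>The products \<open>x ^ i * y ^ j\<close> with exponents below the degrees of the two
  monic equations span a group stable under \<open>x\<close> and under \<open>y\<close>, hence under
  their sum and product.\<close>

lemma algebraic_int_add_mult:
  fixes x y :: "'a::field_char_0"
  assumes "algebraic_int x" "algebraic_int y"
  shows "algebraic_int (x + y)" "algebraic_int (x * y)"
proof -
  obtain n where n: "n > 0" "x ^ n \<in> int_span {..<n} (\<lambda>i. x ^ i)"
    using algebraic_int_power_mem_span[OF assms(1)] by blast
  obtain m where m: "m > 0" "y ^ m \<in> int_span {..<m} (\<lambda>i. y ^ i)"
    using algebraic_int_power_mem_span[OF assms(2)] by blast
  define I where "I = {..<n} \<times> {..<m}"
  define g where "g = (\<lambda>(i, j). x ^ i * y ^ j)"
  have fin: "finite I" by (simp add: I_def)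
  have nz: "\<exists>i\<in>I. g i \<noteq> 0"
    using n m by (intro bexI[of _ "(0, 0)"]) (auto simp: g_def I_def)
  have gen: "x ^ i * y ^ j \<in> int_span I g" if "i < n" "j < m" for i j
    using int_span_gen[OF fin, of "(i, j)" g] that by (auto simp: I_def g_def)
  have x: "x * g k \<in> int_span I g" if k: "k \<in> I" for k
  proof -
    obtain i j where ij: "k = (i, j)" "i < n" "j < m" using k by (auto simp: I_def)
    show ?thesis
    proof (cases "Suc i < n")
      case True
      then show ?thesis using gen[of "Suc i" j] ij by (simp add: g_def mult.assoc)
    next
      case False
      \<comment> \<open>The exponent overflows only here, and the monic equation lowers
        \<open>x ^ n\<close> again.\<close>
      then have "Suc i = n" using ij by simp
      then have "x * g k = y ^ j * x ^ n" by (simp add: ij g_def mult_ac flip: \<open>Suc i = n\<close>)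
      moreover obtain c where "x ^ n = (\<Sum>i<n. of_int (c i) * x ^ i)" 
        using n by (auto simp: int_span_def)
      ultimately have "x * g k = (\<Sum>i<n. of_int (c i) * (x ^ i * y ^ j))"
        by (simp add: sum_distrib_left mult_ac)
      then show ?thesis using ij by (auto intro!: int_span_sum int_span_scale gen)
    qed
  qed
  have y: "y * g k \<in> int_span I g" if k: "k \<in> I" for k
  proof -
    obtain i j where ij: "k = (i, j)" "i < n" "j < m" using k by (auto simp: I_def)
    show ?thesis
    proof (cases "Suc j < m")
      case True
      then show ?thesis using gen[of i "Suc j"] ij by (simp add: g_def mult_ac)
    next
      case False
      then have "Suc j = m" using ij by simp
      then have "y * g k = x ^ i * y ^ m" by (simp add: ij g_def mult_ac flip: \<open>Suc j = m\<close>)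
      moreover obtain c where "y ^ m = (\<Sum>i<m. of_int (c i) * y ^ i)" 
        using m by (auto simp: int_span_def)
      ultimately have "y * g k = (\<Sum>j<m. of_int (c j) * (x ^ i * y ^ j))"
        by (simp add: sum_distrib_left mult_ac)
      then show ?thesis using ij by (auto intro!: int_span_sum int_span_scale gen)
    qed
  qed
  show "algebraic_int (x + y)"
    by (rule algebraic_int_if_stable[OF fin nz]) (simp only: distrib_right int_span_add x y)
  show "algebraic_int (x * y)"
    by (rule algebraic_int_if_stable[OF fin nz]) (simp only: mult.assoc int_span_mult_mem[OF x y])
qed

interpretation alg: subring_set "{x :: 'a::field_char_0. algebraic_int x}"
proof
  fix x y :: 'a
  assume xy: "x \<in> {x. algebraic_int x}" "y \<in> {x. algebraic_int x}"
  then show "x * y \<in> {x. algebraic_int x}" by (simp add: algebraic_int_add_mult)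
  show "x - y \<in> {x. algebraic_int x}"
    using algebraic_int_add_mult(1)[of x "- y"] xy by simp
qed simp

lemmas algebraic_int_mem_intros = alg.mem_intros[unfolded mem_Collect_eq]

lemma algebraic_int_if_power:
  assumes "algebraic_int (x ^ n)" "n > 0" shows "algebraic_int (x :: 'a::field_char_0)"
proof (rule algebraic_int_root[OF assms(1)])
  show "poly (Polynomial.monom 1 n) x = x ^ n" by (simp add: poly_monom)
  show "lead_coeff (Polynomial.monom 1 n) = (1::'a)" by (simp add: Polynomial.degree_monom_eq)
  show "0 < Polynomial.degree (Polynomial.monom (1::'a) n)"
    using assms(2) by (simp add: Polynomial.degree_monom_eq)
qed simp

section \<open>Denominators and inverses of algebraic numbers\<close>

lemma integer_multiple_of_nonzero_root:
  assumes "f \<noteq> 0" "f \<in> polys_over \<int>" "poly f x = 0" "(x :: 'a::field_char_0) \<noteq> 0"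
  shows "\<exists>q n. q \<in> polys_over \<int> \<and> n \<noteq> 0 \<and> x * poly q x = of_int n"
  using assms
proof (induction f rule: pCons_induct)
  case 0
  then show ?case by simp
next
  case (pCons a f)
  have cf: "coeff (pCons a f) i \<in> \<int>" for i
    using pCons.prems(2) by (simp add: polys_over_def)
  have f: "f \<in> polys_over \<int>" "a \<in> \<int>"
    using cf[of "Suc _"] cf[of 0] by (simp_all add: polys_over_def)
  show ?case
  \<comment> \<open>A vanishing constant term lets a factor \<open>X\<close> be stripped because
    \<open>x\<close> is nonzero; a nonvanishing one is, up to sign, the integer sought.\<close>
  proof (cases "a = 0")
    case True
    with pCons f show ?thesis by auto
  next
    case False
    from f obtain k where k: "a = of_int k" by (auto elim: Ints_cases)
    have "x * poly f x = of_int (- k)" using pCons.prems(3) k by (simp add: eq_neg_iff_add_eq_0 add.commute)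
    moreover have "- k \<noteq> 0" using False k by auto
    ultimately show ?thesis using f by blast
  qed
qed

lemma algebraic_int_divides_integer:
  assumes "algebraic_int (x :: 'a::field_char_0)" "x \<noteq> 0"
  obtains q n where "q \<in> polys_over \<int>" "n \<noteq> 0" "x * poly q x = of_int n"
proof -
  from assms obtain f where f: "lead_coeff f = 1" "\<forall>i. coeff f i \<in> \<int>" "poly f x = 0"
    by (auto elim: algebraic_int.cases)
  have "f \<noteq> 0" using f by auto
  with integer_multiple_of_nonzero_root[of f x] f assms that show ?thesis
    by (auto simp: polys_over_def)
qed

lemma clear_denominators:
  fixes f :: "'a::field_char_0 poly"
  assumes "f \<in> polys_over \<rat>"
  shows "\<exists>N::int. N > 0 \<and> Polynomial.smult (of_int N) f \<in> polys_over \<int>"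
  using assms
proof (induction f rule: pCons_induct)
  case 0
  then show ?case by (intro exI[of _ 1]) (auto simp: polys_over_def)
next
  case (pCons a f)
  have cf: "coeff (pCons a f) i \<in> \<rat>" for i
    using pCons.prems by (simp add: polys_over_def)
  have f: "f \<in> polys_over \<rat>" "a \<in> \<rat>"
    using cf[of "Suc _"] cf[of 0] by (simp_all add: polys_over_def)
  from pCons.IH[OF f(1)] obtain N :: int where N: "N > 0" "Polynomial.smult (of_int N) f \<in> polys_over \<int>"
    by blast
  from f(2) obtain c d where cd: "d > 0" "a = of_int c / of_int d" by (auto elim: Rats_cases')
  have "of_int (N * d) * a = of_int (N * c)" using cd by simp
  moreover have "Polynomial.smult (of_int (N * d)) f = Polynomial.smult (of_int d) (Polynomial.smult (of_int N) f)"
    by (simp add: mult.commute)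
  ultimately have "Polynomial.smult (of_int (N * d)) (pCons a f) \<in> polys_over \<int>"
    unfolding smult_pCons using N
    by (simp only:) (intro Ints.pCons_mem Ints.smult_mem[of "of_int d"] Ints.of_int_mem)
  then show ?case using N cd by (intro exI[of _ "N * d"]) auto
qed

lemma ring_adjoin_Rats_clear_denominators:
  assumes "(x :: 'a::field_char_0) \<in> ring_adjoin \<rat> a"
  obtains N :: int where "N > 0" "of_int N * x \<in> ring_adjoin \<int> a"
proof -
  from assms obtain f where f: "f \<in> polys_over \<rat>" "x = poly f a" by (auto simp: ring_adjoin_def)
  obtain N :: int where N: "N > 0" "Polynomial.smult (of_int N) f \<in> polys_over \<int>"
    using clear_denominators[OF f(1)] by blast
  have "of_int N * x = poly (Polynomial.smult (of_int N) f) a" using f by simp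
  then have "of_int N * x \<in> ring_adjoin \<int> a" using N unfolding ring_adjoin_def by blast
  with N that show ?thesis by blast
qed

text \<open>The algebraic integer \<open>N x\<close> divides a nonzero integer, and the cofactor is
  an integer polynomial in \<open>N x\<close>, so it already lies in \<open>A\<close>. This makes
  \<open>K\<close>, and later \<open>E\<close>, a field.\<close>

lemma inverse_mem_if_algebraic:
  fixes A :: "'a::field_char_0 set"
  assumes "subring_set A" "\<rat> \<subseteq> A" "x \<in> A" and N: "(N::int) \<noteq> 0" "algebraic_int (of_int N * x)"
  shows "inverse x \<in> A"
proof (cases "x = 0")
  case False
  interpret subring_set A by fact
  obtain q n where q: "q \<in> polys_over \<int>" "n \<noteq> 0" "of_int N * x * poly q (of_int N * x) = of_int n"
    using algebraic_int_divides_integer[OF N(2)] False N(1) by auto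
  have "polys_over \<int> \<subseteq> polys_over A" using Ints_subset by (auto simp: polys_over_def)
  then have "(of_int N / of_int n) * poly q (of_int N * x) \<in> A"
    using q assms by (intro mult_mem poly_mem of_int_mem) (auto intro: subsetD[OF assms(2)])
  moreover have "inverse x = (of_int N / of_int n) * poly q (of_int N * x)"
    using q False by (simp add: field_simps)
  ultimately show ?thesis by simp
qed (use assms subring_set.zero_mem in auto)

section \<open>Cyclotomic integers of prime conductor\<close>

locale prime_cyclotomic =
  fixes p :: nat and \<zeta> :: complex
  assumes prime_p: "Factorial_Ring.prime p" and odd_p: "odd p"
    and primitive: "primitive_root_of_unity p \<zeta>"
begin

abbreviation R :: "complex set" where "R \<equiv> cyclotomic_ring \<zeta>"

abbreviation K :: "complex set" where "K \<equiv> ring_adjoin \<rat> \<zeta>"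

definition \<pi> :: complex where "\<pi> = 1 - \<zeta>"

sublocale R: subring_set R by (rule Ints.subring_set_ring_adjoin)
sublocale K: subring_set K by (rule Rats.subring_set_ring_adjoin)

lemma p_ge_3: "p \<ge> 3"
  using prime_ge_2_nat[OF prime_p] odd_p by (cases "p = 2") auto

lemma zeta_power_p: "\<zeta> ^ p = 1"
  using primitive by (simp add: primitive_root_of_unity_def)

lemma zeta_nz: "\<zeta> \<noteq> 0"
  using zeta_power_p p_ge_3 by (auto simp: power_0_left)

lemma zeta_power_mod: "\<zeta> ^ (k mod p) = \<zeta> ^ k"
proof -
  have "\<zeta> ^ k = \<zeta> ^ (p * (k div p) + k mod p)" by simp
  also have "\<dots> = \<zeta> ^ (k mod p)" unfolding power_add power_mult zeta_power_p by simp
  finally show ?thesis by simp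
qed

lemma zeta_power_eq_1_iff: "\<zeta> ^ k = 1 \<longleftrightarrow> p dvd k"
proof
  assume "\<zeta> ^ k = 1"
  moreover have "k mod p < p" using p_ge_3 by simp
  ultimately have "k mod p = 0"
    using primitive zeta_power_mod[of k] unfolding primitive_root_of_unity_def
    by (metis gr0I)
  then show "p dvd k" by auto
next
  assume "p dvd k"
  then show "\<zeta> ^ k = 1" using zeta_power_mod[of k] by simp
qed

lemma zeta_mem: "\<zeta> \<in> R" by (rule Ints.gen_mem_ring_adjoin)

lemma pi_mem: "\<pi> \<in> R" unfolding \<pi>_def by (intro R.mem_intros zeta_mem)

lemma pi_nz: "\<pi> \<noteq> 0"
proof -
  have "\<not> p dvd 1" using p_ge_3 by simp
  with zeta_power_eq_1_iff[of 1] show ?thesis by (simp add: \<pi>_def)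
qed

lemma R_subset_K: "R \<subseteq> K"
  by (rule ring_adjoin_subset[OF K.subring_set_axioms K.Ints_subset]) (rule Rats.gen_mem_ring_adjoin)

lemma zeta_algebraic_int: "algebraic_int \<zeta>"
  by (rule algebraic_int_if_power[of _ p]) (use p_ge_3 in \<open>auto simp: zeta_power_p\<close>)

lemma R_algebraic_int: "x \<in> R \<Longrightarrow> algebraic_int x"
  using ring_adjoin_subset[OF alg.subring_set_axioms alg.Ints_subset, of \<zeta>] zeta_algebraic_int
  by blast

section \<open>Factorisation of \<open>x ^ p - b ^ p\<close> and Fourier inversion over the powers
  of \<zeta>\<close>

lemma inj_zeta_power: "inj_on (\<lambda>j. \<zeta> ^ j) {..<p}"
proof (rule linorder_inj_onI')
  fix i j assume ij: "i \<in> {..<p}" "j \<in> {..<p}" "i < j"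
  have "\<zeta> ^ j = \<zeta> ^ i * \<zeta> ^ (j - i)" using ij by (simp flip: power_add)
  moreover have "\<not> p dvd (j - i)" using ij by (auto dest: dvd_imp_le)
  ultimately show "\<zeta> ^ i \<noteq> \<zeta> ^ j" using zeta_power_eq_1_iff[of "j - i"] zeta_nz by auto
qed

text \<open>Both sides are monic of degree \<open>p\<close>, so their difference has degree below
  \<open>p\<close>, yet it vanishes at \<open>p\<close> distinct powers of \<zeta>.\<close>

lemma prod_X_minus_zeta_power: "(\<Prod>j<p. [:- (\<zeta> ^ j), 1:]) = Polynomial.monom 1 p - 1" (is "?P = ?Q")
proof (rule ccontr)
  assume neq: "?P \<noteq> ?Q"
  have P: "Polynomial.degree ?P = p" "coeff ?P p = 1"
    using monic_prod_linear[of "{..<p}" "\<lambda>j. \<zeta> ^ j"] by auto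
  have Q: "coeff (?Q :: complex poly) k = (if k = p then 1 else 0)" if "k \<ge> p" for k
    using that p_ge_3 by (auto simp: coeff_eq_0)
  have deg: "Polynomial.degree (?P - ?Q) < p"
  proof (rule degree_lessI)
    show "\<forall>k\<ge>p. coeff (?P - ?Q) k = 0"
    proof (intro allI impI)
      fix k assume "k \<ge> p"
      with P Q[of k] show "coeff (?P - ?Q) k = 0"
        by (cases "k = p") (auto simp: coeff_eq_0)
    qed
  qed (use p_ge_3 in auto)
  have "card {x. poly (?P - ?Q) x = 0} \<le> Polynomial.degree (?P - ?Q)"
    using neq by (intro card_poly_roots_bound) simp
  moreover have "(\<lambda>j. \<zeta> ^ j) ` {..<p} \<subseteq> {x. poly (?P - ?Q) x = 0}"
  proof
    fix x assume "x \<in> (\<lambda>j. \<zeta> ^ j) ` {..<p}"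
    then obtain j where j: "j < p" "x = \<zeta> ^ j" by auto
    have "poly ?P x = 0" using j by (auto simp: poly_prod)
    moreover have "x ^ p = 1" using j by (metis zeta_power_p power_mult mult.commute power_one)
    ultimately show "x \<in> {x. poly (?P - ?Q) x = 0}" by (simp add: poly_monom)
  qed
  then have "p \<le> card {x. poly (?P - ?Q) x = 0}"
    using card_mono[OF poly_roots_finite, of "?P - ?Q"] neq card_image[OF inj_zeta_power]
    by (metis card_lessThan right_minus_eq)
  ultimately show False using deg by simp
qed

lemma prod_diff_zeta_power: "(\<Prod>j<p. x - \<zeta> ^ j * b) = x ^ p - b ^ p"
proof (cases "b = 0")
  case True
  then show ?thesis using p_ge_3 by (simp add: power_0_left)
next
  case False
  have "(\<Prod>j<p. x - \<zeta> ^ j * b) = (\<Prod>j<p. b * (x / b - \<zeta> ^ j))"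
    using False by (intro prod.cong) (auto simp: field_simps)
  also have "\<dots> = b ^ p * poly (\<Prod>j<p. [:- (\<zeta> ^ j), 1:]) (x / b)"
    by (simp add: prod.distrib poly_prod)
  also have "\<dots> = x ^ p - b ^ p"
    unfolding prod_X_minus_zeta_power using False by (simp add: poly_monom field_simps)
  finally show ?thesis .
qed

lemma sum_zeta_powers: "(\<Sum>j<p. \<zeta> ^ (j * k)) = (if p dvd k then of_nat p else 0)"
proof (cases "p dvd k")
  case True
  then have "\<zeta> ^ (j * k) = 1" for j by (simp add: zeta_power_eq_1_iff)
  then show ?thesis using True by simp
next
  case False
  then have nz: "\<zeta> ^ k \<noteq> 1" by (simp add: zeta_power_eq_1_iff)
  have "(\<Sum>j<p. \<zeta> ^ (j * k)) = (\<Sum>j<p. (\<zeta> ^ k) ^ j)"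
    by (simp add: mult.commute flip: power_mult)
  also have "\<dots> = ((\<zeta> ^ k) ^ p - 1) / (\<zeta> ^ k - 1)" by (rule geometric_sum[OF nz])
  also have "(\<zeta> ^ k) ^ p = 1" by (metis zeta_power_p power_mult mult.commute power_one)
  finally show ?thesis using False by simp
qed

text \<open>Discrete Fourier inversion: orthogonality of the powers of \<zeta> isolates one
  coefficient. The exponent \<open>p - k\<close> stands for \<open>-k\<close> among the
  naturals.\<close>

lemma coeff_from_conjugates:
  assumes g: "Polynomial.degree g < p" and k: "k < p"
  shows "(\<Sum>j<p. \<zeta> ^ (j * (p - k)) * poly g (\<zeta> ^ j * b)) = of_nat p * coeff g k * b ^ k"
proof -
  have "(\<Sum>j<p. \<zeta> ^ (j * (p - k)) * poly g (\<zeta> ^ j * b)) =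
    (\<Sum>j<p. \<Sum>i<p. coeff g i * b ^ i * \<zeta> ^ (j * (p - k + i)))"
    by (simp add: poly_eq_sum_lessThan[OF g] sum_distrib_left power_mult_distrib power_add
      distrib_left mult_ac flip: power_mult)
  also have "\<dots> = (\<Sum>i<p. coeff g i * b ^ i * (\<Sum>j<p. \<zeta> ^ (j * (p - k + i))))"
    by (subst sum.swap) (simp add: sum_distrib_left)
  also have "\<dots> = (\<Sum>i<p. if i = k then of_nat p * coeff g k * b ^ k else 0)"
  proof (intro sum.cong refl)
    fix i assume i: "i \<in> {..<p}"
    \<comment> \<open>The number \<open>p - k + i\<close> lies strictly between 0 and
      \<open>2 * p\<close>, so \<open>p\<close> is the only multiple it can equal.\<close>
    have "p dvd (p - k + i) \<longleftrightarrow> i = k"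
    proof
      assume "p dvd p - k + i"
      then obtain q where q: "p - k + i = p * q" by auto
      have "q > 0" using q k by (intro gr0I) auto
      moreover have "p - k + i < p * 2" using i k by auto
      then have "q < 2" unfolding q by (simp only: mult_less_cancel1)
      ultimately have "q = 1" by simp
      with q k show "i = k" by auto
    qed (use k in auto)
    then show "coeff g i * b ^ i * (\<Sum>j<p. \<zeta> ^ (j * (p - k + i))) =
      (if i = k then of_nat p * coeff g k * b ^ k else 0)"
      unfolding sum_zeta_powers by auto
  qed
  also have "\<dots> = of_nat p * coeff g k * b ^ k" using k by simp
  finally show ?thesis .
qed

section \<open>The \<open>p\<close>-th cyclotomic polynomial and the ramification of
  \<open>p\<close>\<close>

definition \<Phi> :: "complex poly" where "\<Phi> = (\<Sum>i<p. Polynomial.monom 1 i)"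

lemma coeff_Phi: "coeff \<Phi> i = (if i < p then 1 else 0)"
  by (simp add: \<Phi>_def coeff_sum sum.delta)

lemma degree_Phi: "Polynomial.degree \<Phi> = p - 1"
  using p_ge_3 by (intro antisym degree_le le_degree) (auto simp: coeff_Phi)

lemma Phi_monic: "lead_coeff \<Phi> = 1"
  using p_ge_3 by (simp add: degree_Phi coeff_Phi)

lemma Phi_Ints: "\<Phi> \<in> polys_over \<int>"
  by (simp add: polys_over_def coeff_Phi)

lemma poly_Phi: "poly \<Phi> x = (\<Sum>i<p. x ^ i)"
  by (simp add: \<Phi>_def poly_sum poly_monom)

lemma Phi_root: "\<not> p dvd j \<Longrightarrow> poly \<Phi> (\<zeta> ^ j) = 0"
  using sum_zeta_powers[of j] by (simp add: poly_Phi mult.commute flip: power_mult)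

lemma Phi_root_zeta: "poly \<Phi> \<zeta> = 0"
  using Phi_root[of 1] p_ge_3 by simp

text \<open>Cancelling \<open>X - 1\<close> from two factorisations of \<open>X ^ p - 1\<close> and
  evaluating at 1.\<close>

lemma prod_one_minus_zeta_power: "(\<Prod>j\<in>{1..<p}. 1 - \<zeta> ^ j) = of_nat p"
proof -
  have "[:-1, 1:] * (\<Prod>j\<in>{1..<p}. [:- (\<zeta> ^ j), 1:]) = (\<Prod>j<p. [:- (\<zeta> ^ j), 1:])"
    using p_ge_3 by (simp add: prod.atLeast_Suc_lessThan atLeast0LessThan[symmetric])
  also have "\<dots> = [:-1, 1:] * \<Phi>"
  proof (subst poly_eq_poly_eq_iff[symmetric], rule ext)
    fix x
    show "poly (\<Prod>j<p. [:- (\<zeta> ^ j), 1:]) x = poly ([:-1, 1:] * \<Phi>) x"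
      unfolding prod_X_minus_zeta_power using one_diff_power_eq[of x p]
      by (simp add: poly_monom poly_Phi algebra_simps)
  qed
  finally have "(\<Prod>j\<in>{1..<p}. [:- (\<zeta> ^ j), 1:]) = \<Phi>" by (simp del: mult_pCons_left)
  then have "poly (\<Prod>j\<in>{1..<p}. [:- (\<zeta> ^ j), 1:]) 1 = poly \<Phi> 1" by simp
  then show ?thesis by (simp add: poly_prod poly_Phi)
qed

text \<open>The sum is the quotient of \<open>1 - \<zeta> ^ j\<close> by \<open>1 - \<zeta>\<close>.
  With \<open>k\<close> inverse to \<open>j\<close> modulo \<open>p\<close>, \<zeta> is the
  \<open>k\<close>-th power of \<open>\<zeta> ^ j\<close>, so the division also works the other way
  round.\<close>

lemma cyclotomic_unit:
  assumes "j \<in> {1..<p}"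
  shows "\<exists>w\<in>R. (\<Sum>i<j. \<zeta> ^ i) * w = 1"
proof -
  have "coprime j p"
    using assms prime_p by (metis atLeastLessThan_iff coprime_commute nat_dvd_not_less
      not_less_eq_eq One_nat_def prime_imp_coprime_nat zero_less_Suc order_less_le_trans)
  then obtain k where k: "[j * k = Suc 0] (mod p)" using cong_solve_coprime_nat by blast
  define w where "w = (\<Sum>i<k. (\<zeta> ^ j) ^ i)"
  have "w \<in> R" unfolding w_def by (intro R.mem_intros zeta_mem)
  have "\<zeta> ^ (j * k) = \<zeta>"
    using k zeta_power_mod[of "j * k"] zeta_power_mod[of 1] by (simp add: cong_def)
  then have "\<pi> = 1 - (\<zeta> ^ j) ^ k" by (simp add: \<pi>_def power_mult)
  also have "\<dots> = (1 - \<zeta> ^ j) * w" unfolding w_def by (rule one_diff_power_eq)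
  also have "1 - \<zeta> ^ j = \<pi> * (\<Sum>i<j. \<zeta> ^ i)" unfolding \<pi>_def by (rule one_diff_power_eq)
  finally have "(\<Sum>i<j. \<zeta> ^ i) * w = 1" using pi_nz by (simp add: mult.assoc)
  with \<open>w \<in> R\<close> show ?thesis by blast
qed

text \<open>Total ramification: each of the \<open>p - 1\<close> factors
  \<open>1 - \<zeta> ^ j\<close> of \<open>p\<close> is \<pi> times a cyclotomic unit.\<close>

lemma p_eq_unit_times_pi_power:
  obtains u v where "u \<in> R" "v \<in> R" "u * v = 1" "of_nat p = u * \<pi> ^ (p - 1)"
proof -
  obtain w where w: "\<And>j. j \<in> {1..<p} \<Longrightarrow> w j \<in> R \<and> (\<Sum>i<j. \<zeta> ^ i) * w j = 1"
    using cyclotomic_unit by metis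
  define u where "u = (\<Prod>j\<in>{1..<p}. \<Sum>i<j. \<zeta> ^ i)"
  define v where "v = (\<Prod>j\<in>{1..<p}. w j)"
  have "of_nat p = (\<Prod>j\<in>{1..<p}. \<pi> * (\<Sum>i<j. \<zeta> ^ i))"
    unfolding prod_one_minus_zeta_power[symmetric] \<pi>_def
    by (intro prod.cong refl one_diff_power_eq)
  then have "of_nat p = u * \<pi> ^ (p - 1)" by (simp add: prod.distrib u_def mult.commute)
  moreover have "u * v = 1" unfolding u_def v_def prod.distrib[symmetric]
    using w by (intro prod.neutral) auto
  moreover have "u \<in> R" "v \<in> R"
    unfolding u_def v_def using w by (auto intro!: R.prod_mem R.sum_mem R.power_mem zeta_mem)
  ultimately show ?thesis using that by blast
qed

text \<open>The power \<open>p - 1\<close> turns the denominator \<pi> into \<open>p\<close> up to a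
  unit, and a rational algebraic integer is an integer.\<close>

lemma prime_dvd_if_pi_dvd:
  assumes "algebraic_int (of_int n / \<pi>)"
  shows "int p dvd n"
proof -
  obtain u v where uv: "u \<in> R" "v \<in> R" "u * v = 1" "of_nat p = u * \<pi> ^ (p - 1)"
    by (rule p_eq_unit_times_pi_power)
  have v: "v * of_nat p = \<pi> ^ (p - 1)" using uv by (simp add: mult_ac)
  have "(of_int n / \<pi>) ^ (p - 1) * v = (of_int (n ^ (p - 1)) / of_nat p :: complex)"
    unfolding power_divide v[symmetric] using uv(3) by auto
  then have "algebraic_int (of_int (n ^ (p - 1)) / of_nat p :: complex)"
    using assms uv R_algebraic_int[of v] by (metis algebraic_int_mem_intros(6,7))
  then have "of_int (n ^ (p - 1)) / of_nat p \<in> (\<int> :: complex set)"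
    by (rule rational_algebraic_int_is_int) (auto simp del: of_int_power)
  then obtain k where "of_int (n ^ (p - 1)) / of_nat p = (of_int k :: complex)"
    by (auto elim: Ints_cases)
  then have "(of_int (n ^ (p - 1)) :: complex) = of_int (k * int p)"
    using p_ge_3 by (simp add: field_simps)
  then have "n ^ (p - 1) = k * int p" by (simp only: of_int_eq_iff)
  then have "int p dvd n ^ (p - 1)" by simp
  then show ?thesis using prime_p prime_dvd_power_int by auto
qed

text \<open>Induction from the lowest coefficient upwards: once the lower terms, already multiples
  of \<open>p\<close>, are removed, \<open>a k\<close> is the coefficient of the lowest power of
  \<pi> left, and so must be divisible by \<pi>.\<close>

lemma coeffs_dvd_if_pi_expansion_dvd:
  fixes a :: "nat \<Rightarrow> int"
  assumes "algebraic_int ((\<Sum>i<p - 1. of_int (a i) * \<pi> ^ i) / of_nat p)"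
  shows "k < p - 1 \<Longrightarrow> int p dvd a k"
proof (induction k rule: less_induct)
  case (less k)
  obtain u v where uv: "u \<in> R" "v \<in> R" "u * v = 1" "of_nat p = u * \<pi> ^ (p - 1)"
    by (rule p_eq_unit_times_pi_power)
  have pi_nz': "\<pi> \<noteq> 0" and p_nz: "(of_nat p :: complex) \<noteq> 0" using pi_nz p_ge_3 by auto
  let ?s = "\<lambda>A. (\<Sum>i\<in>A. of_int (a i) * \<pi> ^ i)"
  have split: "?s {..<p - 1} = ?s {..<k} + of_int (a k) * \<pi> ^ k + ?s {Suc k..<p - 1}"
  proof -
    have "?s {0..<Suc k} + ?s {Suc k..<p - 1} = ?s {0..<p - 1}"
      using less.prems by (intro sum.atLeastLessThan_concat) auto
    then show ?thesis unfolding atLeast0LessThan sum.lessThan_Suc by (rule sym)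
  qed
  have low: "algebraic_int (?s {..<k} / of_nat p)"
  proof -
    have "?s {..<k} / of_nat p = (\<Sum>i<k. of_int (a i div int p) * \<pi> ^ i)"
      unfolding sum_divide_distrib
    proof (intro sum.cong refl)
      fix i assume "i \<in> {..<k}"
      then have "a i = a i div int p * int p" using less by simp
      then have "(of_int (a i) :: complex) = of_int (a i div int p) * of_nat p"
        by (metis of_int_mult of_int_of_nat_eq)
      then show "of_int (a i) * \<pi> ^ i / of_nat p = of_int (a i div int p) * \<pi> ^ i"
        using p_nz by simp
    qed
    then show ?thesis using R_algebraic_int pi_mem by (simp add: algebraic_int_mem_intros)
  qed
  \<comment> \<open>The last factor replaces the denominator \<open>p\<close> by
    \<open>\<pi> ^ Suc k\<close>, so that \<open>a k\<close> over \<pi> is the only fractional term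
    left.\<close>
  have "algebraic_int ((?s {..<p - 1} / of_nat p - ?s {..<k} / of_nat p) * (u * \<pi> ^ (p - 1 - Suc k)))"
    using assms low uv R_algebraic_int pi_mem by (intro algebraic_int_mem_intros) auto
  also have "(?s {..<p - 1} / of_nat p - ?s {..<k} / of_nat p) * (u * \<pi> ^ (p - 1 - Suc k)) =
    (of_int (a k) * \<pi> ^ k + ?s {Suc k..<p - 1}) / \<pi> ^ Suc k"
  proof -
    have "\<pi> ^ (p - 1) = \<pi> ^ (p - 1 - Suc k) * \<pi> ^ Suc k"
      unfolding power_add[symmetric] using less.prems
      by (intro arg_cong[of _ _ "\<lambda>n. \<pi> ^ n"]) simp
    then have "u * \<pi> ^ (p - 1 - Suc k) / of_nat p = 1 / \<pi> ^ Suc k"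
      using uv pi_nz' by (auto simp: field_simps)
    moreover have "(x / y - z / y) * c = (x - z) * (c / y)" for x y z c :: complex
      by (cases "y = 0") (simp_all add: field_simps)
    ultimately show ?thesis unfolding split by (simp only:) simp
  qed
  also have "\<dots> = of_int (a k) / \<pi> + (\<Sum>i\<in>{Suc k..<p - 1}. of_int (a i) * \<pi> ^ (i - Suc k))"
  proof -
    have "?s {Suc k..<p - 1} / \<pi> ^ Suc k = (\<Sum>i\<in>{Suc k..<p - 1}. of_int (a i) * \<pi> ^ (i - Suc k))"
      unfolding sum_divide_distrib
    proof (intro sum.cong refl)
      fix i assume "i \<in> {Suc k..<p - 1}"
      then have "\<pi> ^ i = \<pi> ^ (i - Suc k) * \<pi> ^ Suc k"
        unfolding power_add[symmetric] by simp
      then show "of_int (a i) * \<pi> ^ i / \<pi> ^ Suc k = of_int (a i) * \<pi> ^ (i - Suc k)"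
        using pi_nz' by simp
    qed
    then show ?thesis using pi_nz' by (simp add: add_divide_distrib)
  qed
  finally have "algebraic_int (of_int (a k) / \<pi> + (\<Sum>i\<in>{Suc k..<p - 1}. of_int (a i) * \<pi> ^ (i - Suc k))
     - (\<Sum>i\<in>{Suc k..<p - 1}. of_int (a i) * \<pi> ^ (i - Suc k)))"
    using R_algebraic_int pi_mem by (intro algebraic_int_mem_intros(5)) (auto intro!: algebraic_int_mem_intros(6-9,11))
  then show ?case using prime_dvd_if_pi_dvd by simp
qed

lemma K_inverse: "x \<in> K \<Longrightarrow> inverse x \<in> K"
proof -
  assume x: "x \<in> K"
  then obtain N :: int where N: "N > 0" "of_int N * x \<in> R" by (rule ring_adjoin_Rats_clear_denominators)
  show ?thesis
    by (rule inverse_mem_if_algebraic[OF K.subring_set_axioms Rats.base_subset_ring_adjoin x, of N])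
       (use N R_algebraic_int in auto)
qed

lemma K_divide: "x \<in> K \<Longrightarrow> y \<in> K \<Longrightarrow> x / y \<in> K"
  unfolding divide_inverse by (intro K.mult_mem K_inverse)

section \<open>Linear independence of the powers of \<zeta> over the rationals\<close>

lemma pi_poly_divisible:
  assumes f: "f \<in> polys_over \<int>" "Polynomial.degree f < p - 1"
    and alg: "algebraic_int (poly f \<pi> / of_nat p)"
  shows "Polynomial.smult (1 / of_nat p) f \<in> polys_over \<int>"
proof -
  have "\<forall>i. \<exists>n. coeff f i = of_int n" using f by (auto simp: polys_over_def elim: Ints_cases)
  then obtain a where a: "\<And>i. coeff f i = of_int (a i)" by metis
  have "poly f \<pi> = (\<Sum>i<p - 1. of_int (a i) * \<pi> ^ i)"
    using poly_eq_sum_lessThan[OF f(2)] by (simp add: a)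
  with alg have dvd: "int p dvd a k" if "k < p - 1" for k
    using coeffs_dvd_if_pi_expansion_dvd[OF _ that] by simp
  have "coeff f k / of_nat p \<in> \<int>" for k
  proof (cases "k < p - 1")
    case True
    then obtain m where "a k = int p * m" using dvd by (auto elim: dvdE)
    then show ?thesis using p_ge_3 by (simp add: a)
  next
    case False
    then show ?thesis using f by (simp add: coeff_eq_0)
  qed
  then show ?thesis by (simp add: polys_over_def)
qed

text \<open>Infinite descent: the value 0 stays integral after every division by \<open>p\<close>,
  so each coefficient is divisible by all powers of \<open>p\<close>.\<close>

lemma pi_poly_zero_Ints:
  assumes f: "f \<in> polys_over \<int>" "Polynomial.degree f < p - 1" and zero: "poly f \<pi> = 0"
  shows "f = 0"
proof -
  have descent: "Polynomial.smult (1 / of_nat p ^ n) f \<in> polys_over \<int>" for n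
  proof (induction n)
    case (Suc n)
    have "Polynomial.smult (1 / of_nat p) (Polynomial.smult (1 / of_nat p ^ n) f) \<in> polys_over \<int>"
      using Suc f zero by (intro pi_poly_divisible) auto
    then show ?case by (simp add: mult.commute)
  qed (use f in simp)
  show ?thesis
  proof (rule poly_eqI, rule ccontr)
    fix k assume nz: "coeff f k \<noteq> coeff 0 k"
    obtain c where c: "coeff f k = of_int c" using f by (auto simp: polys_over_def elim: Ints_cases)
    \<comment> \<open>This exponent is large enough, since
      \<open>p ^ n \<ge> 2 ^ n > n = \<bar>c\<bar>\<close>.\<close>
    define n where "n = nat \<bar>c\<bar>"
    have "coeff f k / of_nat p ^ n \<in> \<int>" using descent[of n] by (simp add: polys_over_def)
    then obtain m where "coeff f k / of_nat p ^ n = of_int m" by (auto elim: Ints_cases)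
    then have "(of_int c :: complex) = of_int (m * int p ^ n)" using p_ge_3 c by (simp add: field_simps)
    then have cm: "c = m * int p ^ n" by (simp only: of_int_eq_iff)
    moreover have "c \<noteq> 0" using nz c by simp
    ultimately have "int p ^ n \<le> \<bar>c\<bar>" using dvd_imp_le_int[of c "int p ^ n"] by simp
    moreover have "n < 2 ^ n" by simp
    moreover have "(2::int) ^ n \<le> int p ^ n" using p_ge_3 by (intro power_mono) auto
    ultimately have "int n < \<bar>c\<bar>"
      by (metis of_nat_less_numeral_power_cancel_iff order_less_le_trans)
    then show False by (simp add: n_def)
  qed
qed

text \<open>The substitution \<open>1 - X\<close> moves a root \<zeta> to \<pi>. Together with
  \<open>Phi_root_zeta\<close> the result makes \<Phi> the minimal polynomial of \<zeta>.\<close>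

lemma zeta_poly_zero:
  assumes f: "f \<in> polys_over \<rat>" "Polynomial.degree f < p - 1" and zero: "poly f \<zeta> = 0"
  shows "f = 0"
proof -
  obtain N :: int where N: "N > 0" "Polynomial.smult (of_int N) f \<in> polys_over \<int>"
    using clear_denominators[OF f(1)] by blast
  define g where "g = pcompose (Polynomial.smult (of_int N) f) [:1, -1:]"
  have "g \<in> polys_over \<int>" unfolding g_def
    using N by (intro Ints.pcompose_mem Ints.pCons_mem) (auto simp: polys_over_def)
  moreover have "Polynomial.degree g < p - 1" using f N by (simp add: g_def)
  moreover have "poly g \<pi> = 0" using zero by (simp add: g_def poly_pcompose \<pi>_def)
  ultimately have "g = 0" by (rule pi_poly_zero_Ints)
  then have "Polynomial.smult (of_int N) f = 0"
    unfolding g_def by (rule pcompose_eq_0) simp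
  then show ?thesis using N by simp
qed

section \<open>Conjugation, and integral closedness of \<open>R\<close>\<close>

lemma degree_Phi_pos: "Polynomial.degree \<Phi> > 0"
  using p_ge_3 by (simp add: degree_Phi)

lemma Phi_Rats: "\<Phi> \<in> polys_over \<rat>"
  using Phi_Ints by (auto simp: polys_over_def intro: subsetD[OF Ints_subset_Rats])

text \<open>Division by \<Phi> leaves remainder 0, and \<Phi> vanishes at all these powers. This
  serves in place of the automorphisms of \<open>K\<close>.\<close>

lemma zeta_conjugate_root:
  assumes f: "f \<in> polys_over \<rat>" "poly f \<zeta> = 0" and j: "\<not> p dvd j"
  shows "poly f (\<zeta> ^ j) = 0"
proof -
  obtain q r where qr: "q \<in> polys_over \<rat>" "r \<in> polys_over \<rat>" "f = q * \<Phi> + r"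
    "Polynomial.degree r < Polynomial.degree \<Phi>"
    by (rule Rats.division_by_monic[OF Phi_Rats Phi_monic degree_Phi_pos f(1)])
  have "poly r \<zeta> = 0" using f qr Phi_root_zeta by simp
  then have "r = 0" using qr by (intro zeta_poly_zero) (auto simp: degree_Phi)
  then show ?thesis using qr Phi_root[OF j] by simp
qed

text \<open>Composing a monic integer equation of \<open>poly g \<zeta>\<close> with
  \<open>g\<close> gives a rational polynomial with root \<zeta>, whose roots are stable under
  conjugation.\<close>

lemma zeta_conjugate_algebraic_int:
  assumes g: "g \<in> polys_over \<rat>" "algebraic_int (poly g \<zeta>)" and j: "\<not> p dvd j"
  shows "algebraic_int (poly g (\<zeta> ^ j))"
proof -
  from g obtain h where h: "lead_coeff h = 1" "\<forall>i. coeff h i \<in> \<int>" "poly h (poly g \<zeta>) = 0"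
    by (auto elim: algebraic_int.cases)
  have "h \<in> polys_over \<rat>"
    using h by (auto simp: polys_over_def intro: subsetD[OF Ints_subset_Rats])
  then have "pcompose h g \<in> polys_over \<rat>" using g by (intro Rats.pcompose_mem)
  from zeta_conjugate_root[OF this _ j] h have "poly h (poly g (\<zeta> ^ j)) = 0"
    by (simp add: poly_pcompose)
  with h show ?thesis by (intro algebraic_int.intros)
qed

text \<open>Fourier inversion over the conjugates shows that \<open>p\<close> times each coefficient
  of \<open>g\<close> is an integer; the expansion in powers of \<pi> then removes the factor
  \<open>p\<close>.\<close>

lemma R_integrally_closed:
  assumes x: "x \<in> K" "algebraic_int x"
  shows "x \<in> R"
proof -
  obtain g where g: "g \<in> polys_over \<rat>" "Polynomial.degree g < Polynomial.degree \<Phi>" "x = poly g \<zeta>"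
    by (rule Rats.ring_adjoin_reduced[OF Phi_Rats Phi_monic degree_Phi_pos Phi_root_zeta x(1)])
  have deg: "Polynomial.degree g < p - 1" using g by (simp add: degree_Phi)
  then have degp: "Polynomial.degree g < p" by simp
  have conj: "algebraic_int (poly g (\<zeta> ^ j))" if "j \<in> {1..<p}" for j
  proof (rule zeta_conjugate_algebraic_int)
    show "\<not> p dvd j" using that by (auto dest: dvd_imp_le)
  qed (use g x in auto)
  have zeta_alg: "algebraic_int (\<zeta> ^ i)" for i
    by (intro R_algebraic_int R.power_mem zeta_mem)
  have split: "(\<Sum>j<p. \<zeta> ^ (j * m) * poly g (\<zeta> ^ j)) =
    poly g 1 + (\<Sum>j\<in>{1..<p}. \<zeta> ^ (j * m) * poly g (\<zeta> ^ j))" for m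
    using p_ge_3 by (simp add: sum.atLeast_Suc_lessThan atLeast0LessThan[symmetric])
  have tail: "algebraic_int (\<Sum>j\<in>{1..<p}. \<zeta> ^ (j * m) * poly g (\<zeta> ^ j))" for m
    using conj zeta_alg by (intro algebraic_int_mem_intros(6,8))
  \<comment> \<open>The value at 1 is not a conjugate of \<open>x\<close>. As the coefficient of
    index \<open>p - 1\<close> vanishes, inversion at that index (weight exponent 1) expresses this
    value through the conjugates.\<close>
  have g1: "algebraic_int (poly g 1)"
  proof -
    have "poly g 1 + (\<Sum>j\<in>{1..<p}. \<zeta> ^ (j * 1) * poly g (\<zeta> ^ j)) = 0"
      using coeff_from_conjugates[OF degp, of "p - 1" 1] split[of 1] p_ge_3 deg by (simp add: coeff_eq_0)
    then have "poly g 1 = - (\<Sum>j\<in>{1..<p}. \<zeta> ^ (j * 1) * poly g (\<zeta> ^ j))"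
      by (simp add: eq_neg_iff_add_eq_0)
    then show ?thesis using tail[of 1] by simp
  qed
  have "of_nat p * coeff g k \<in> \<int>" for k
  proof (cases "k < p")
    case True
    have "of_nat p * coeff g k = poly g 1 + (\<Sum>j\<in>{1..<p}. \<zeta> ^ (j * (p - k)) * poly g (\<zeta> ^ j))"
      using coeff_from_conjugates[OF degp True, of 1] split[of "p - k"] by simp
    then have "algebraic_int (of_nat p * coeff g k)"
      using g1 tail by (simp only: algebraic_int_mem_intros)
    moreover have "of_nat p * coeff g k \<in> \<rat>" using g by (auto simp: polys_over_def)
    ultimately show ?thesis by (rule rational_algebraic_int_is_int)
  next
    case False
    then show ?thesis using degp by (simp add: coeff_eq_0)
  qed
  then have pg: "Polynomial.smult (of_nat p) g \<in> polys_over \<int>" by (simp add: polys_over_def)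
  \<comment> \<open>The expansion of \<open>p * x\<close> in powers of \<pi>, obtained from
    \<open>\<zeta> = 1 - \<pi>\<close>.\<close>
  define h where "h = pcompose (Polynomial.smult (of_nat p) g) [:1, -1:]"
  have "Polynomial.smult (1 / of_nat p) h \<in> polys_over \<int>"
  proof (rule pi_poly_divisible)
    show "h \<in> polys_over \<int>" unfolding h_def
      using pg by (intro Ints.pcompose_mem Ints.pCons_mem) (auto simp: polys_over_def)
    show "Polynomial.degree h < p - 1" using deg by (simp add: h_def)
    show "algebraic_int (poly h \<pi> / of_nat p)"
      using x g p_ge_3 by (simp add: h_def poly_pcompose \<pi>_def)
  qed
  then have "Polynomial.smult (1 / of_nat p) h \<in> polys_over R"
    using R.Ints_subset by (auto simp: polys_over_def)
  then have "poly (Polynomial.smult (1 / of_nat p) h) \<pi> \<in> R" by (intro R.poly_mem pi_mem)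
  also have "poly (Polynomial.smult (1 / of_nat p) h) \<pi> = x"
    using g p_ge_3 by (simp add: h_def poly_pcompose \<pi>_def)
  finally show ?thesis .
qed

section \<open>Residues modulo \<pi> and primality of \<pi>\<close>

lemma residue_mod_pi:
  assumes "r \<in> R" obtains n :: int and s where "s \<in> R" "r = of_int n + \<pi> * s"
proof -
  from assms obtain f where f: "f \<in> polys_over \<int>" "r = poly f \<zeta>" by (auto simp: ring_adjoin_def)
  have "\<exists>n s. s \<in> R \<and> poly f \<zeta> = of_int n + \<pi> * s" using f(1)
  proof (induction f rule: pCons_induct)
    case 0
    show ?case by (intro exI[of _ 0]) (auto intro: R.zero_mem)
  next
    case (pCons a f)
    have cf: "coeff (pCons a f) i \<in> \<int>" for i
      using pCons.prems by (simp add: polys_over_def)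
    have f: "f \<in> polys_over \<int>" "a \<in> \<int>"
      using cf[of "Suc _"] cf[of 0] by (simp_all add: polys_over_def)
    from pCons.IH[OF f(1)] obtain n s where ns: "s \<in> R" "poly f \<zeta> = of_int n + \<pi> * s" by blast
    from f(2) obtain k where k: "a = of_int k" by (auto elim: Ints_cases)
    \<comment> \<open>Modulo \<pi> the number \<zeta> is 1, so a Horner step just adds the integer
      residues.\<close>
    have "poly (pCons a f) \<zeta> = of_int (k + n) + \<pi> * (\<zeta> * s - of_int n)"
      unfolding poly_pCons ns(2) k by (simp add: \<pi>_def algebra_simps)
    moreover have "\<zeta> * s - of_int n \<in> R" by (intro R.mem_intros ns zeta_mem)
    ultimately show ?case by blast
  qed
  with f that show ?thesis by blast
qed

lemma p_in_pi_power: "k \<le> p - 1 \<Longrightarrow> \<exists>s\<in>R. of_nat p = \<pi> ^ k * s"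
proof -
  assume k: "k \<le> p - 1"
  obtain u v where uv: "u \<in> R" "v \<in> R" "u * v = 1" "of_nat p = u * \<pi> ^ (p - 1)"
    by (rule p_eq_unit_times_pi_power)
  have "of_nat p = \<pi> ^ k * (\<pi> ^ (p - 1 - k) * u)"
  proof -
    have "\<pi> ^ k * \<pi> ^ (p - 1 - k) = \<pi> ^ (p - 1)"
      unfolding power_add[symmetric] using k by (intro arg_cong[of _ _ "\<lambda>n. \<pi> ^ n"]) simp
    then show ?thesis unfolding uv(4) mult.assoc[symmetric] by (simp only: mult.commute)
  qed
  moreover have "\<pi> ^ (p - 1 - k) * u \<in> R" by (intro R.mem_intros pi_mem uv)
  ultimately show ?thesis by blast
qed

text \<open>Both factors are integers modulo \<pi>, and an integer divisible by \<pi> is divisible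
  by \<open>p\<close>, so primality of \<open>p\<close> carries over.\<close>

lemma pi_prime:
  assumes r: "r \<in> R" and s: "s \<in> R" and rs: "r * s / \<pi> \<in> R"
  shows "r / \<pi> \<in> R \<or> s / \<pi> \<in> R"
proof -
  obtain n r' where n: "r' \<in> R" "r = of_int n + \<pi> * r'" using residue_mod_pi[OF r] by blast
  obtain m s' where m: "s' \<in> R" "s = of_int m + \<pi> * s'" using residue_mod_pi[OF s] by blast
  have "of_int (n * m) / \<pi> = r * s / \<pi> - (of_int n * s' + r' * of_int m + \<pi> * r' * s')"
    using n m pi_nz by (simp add: field_simps)
  moreover have "\<dots> \<in> R" by (intro R.mem_intros n m rs pi_mem)
  ultimately have "int p dvd n * m" using R_algebraic_int by (intro prime_dvd_if_pi_dvd) auto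
  then have "int p dvd n \<or> int p dvd m" using prime_p by (metis prime_dvd_mult_iff prime_nat_int_transfer)
  moreover have "(of_int a + \<pi> * t) / \<pi> \<in> R" if dvd: "int p dvd a" and t: "t \<in> R" for a t
  proof -
    obtain b where b: "a = int p * b" using dvd by (rule dvdE)
    obtain q where q: "q \<in> R" "of_nat p = \<pi> ^ 1 * q" using p_in_pi_power[of 1] p_ge_3 by fastforce
    have "(of_int a + \<pi> * t) / \<pi> = q * of_int b + t" using pi_nz b q by (simp add: field_simps)
    then show ?thesis using q t by (simp add: R.mem_intros)
  qed
  ultimately show ?thesis using n m by blast
qed

lemma pi_prime_power:
  assumes "r \<in> R" "r ^ n / \<pi> \<in> R" shows "r / \<pi> \<in> R"
  using assms(2)
proof (induction n)
  case 0
  then have "r * (1 / \<pi>) \<in> R" using assms by (intro R.mult_mem) auto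
  then show ?case by simp
next
  case (Suc n)
  then show ?case using pi_prime[OF assms(1) R.power_mem[OF assms(1), of n]] by auto
qed

lemma one_over_pi_notin: "1 / \<pi> \<notin> R"
proof
  assume "1 / \<pi> \<in> R"
  then have "int p dvd 1" using R_algebraic_int by (intro prime_dvd_if_pi_dvd) auto
  then show False using p_ge_3 by simp
qed

text \<open>Fermat's little theorem, by induction on naturals; the oddness of \<open>p\<close>
  extends it to negative integers.\<close>

lemma int_power_minus_self_dvd: "int p dvd n ^ p - n"
proof -
  have nat: "int p dvd int k ^ p - int k" for k
  proof (induction k)
    case 0
    then show ?case using p_ge_3 by (simp add: power_0_left)
  next
    case (Suc k)
    obtain w where "(int k + 1) ^ p = int k ^ p + 1 ^ p + int p * w"
      using Ints.freshmans_dream[OF prime_p, of "int k" 1] by auto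
    then have "int (Suc k) ^ p - int (Suc k) = (int k ^ p - int k) + int p * w" by (simp add: add.commute)
    then show ?case using Suc by (simp only: dvd_add dvd_triv_left)
  qed
  show ?thesis
  proof (cases "n \<ge> 0")
    case True
    then show ?thesis using nat[of "nat n"] by simp
  next
    case False
    then have "n ^ p - n = - (int (nat (- n)) ^ p - int (nat (- n)))" using odd_p by simp
    then show ?thesis using nat[of "nat (- n)"] by (simp only: dvd_minus_iff)
  qed
qed

text \<open>Fermat applied to the integer residue of \<open>r\<close>. Thus the congruence for
  \<alpha> always holds modulo \<pi>, and only its second order is a condition.\<close>

lemma power_p_minus_self_mod_pi:
  assumes "r \<in> R" shows "(r ^ p - r) / \<pi> \<in> R"
proof -
  obtain n s where n: "s \<in> R" "r = of_int n + \<pi> * s" using residue_mod_pi[OF assms] by blast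
  obtain b where b: "n ^ p - n = int p * b" using int_power_minus_self_dvd by (auto elim: dvdE)
  obtain q where q: "q \<in> R" "of_nat p = \<pi> ^ 1 * q" using p_in_pi_power[of 1] p_ge_3 by fastforce
  define t where "t = (\<Sum>i<p. of_int n ^ (p - Suc i) * r ^ i)"
  have "t \<in> R" unfolding t_def by (intro R.mem_intros assms)
  have "r ^ p - of_int n ^ p = (r - of_int n) * t"
    unfolding t_def by (rule power_diff_sumr2)
  moreover have "of_int n ^ p - of_int n = \<pi> * q * of_int b"
    using b q by (metis of_int_diff of_int_power of_int_mult of_int_of_nat_eq power_one_right)
  ultimately have "r ^ p - r = \<pi> * (s * t + q * of_int b - s)"
    using n by (simp add: algebra_simps)
  then have "(r ^ p - r) / \<pi> = s * t + q * of_int b - s" using pi_nz by simp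
  then show ?thesis using n q \<open>t \<in> R\<close> by (simp add: R.mem_intros)
qed

end

section \<open>Ideals of subrings\<close>

lemma subring_on_simps [simp]:
  "carrier (subring_on S) = S" "x \<otimes>\<^bsub>subring_on S\<^esub> y = x * y" "x \<oplus>\<^bsub>subring_on S\<^esub> y = x + y"
  "\<one>\<^bsub>subring_on S\<^esub> = 1" "\<zero>\<^bsub>subring_on S\<^esub> = 0"
  by (simp_all add: subring_on_def ring_of_type_algebra_def)

context subring_set
begin

lemma cring_subring_on: "cring (subring_on S)"
proof (rule cringI)
  show "abelian_group (subring_on S)"
  proof (rule abelian_groupI)
    show "\<exists>y\<in>carrier (subring_on S). y \<oplus>\<^bsub>subring_on S\<^esub> x = \<zero>\<^bsub>subring_on S\<^esub>"
      if "x \<in> carrier (subring_on S)" for x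
      using that by (intro bexI[of _ "- x"]) (auto intro: minus_mem)
  qed (auto intro: mem_intros)
  show "comm_monoid (subring_on S)"
    by (rule comm_monoidI) (auto intro: mem_intros simp: mult_ac)
qed (auto simp: distrib_right)

lemma ring_subring_on: "ring (subring_on S)"
  using cring_subring_on by (rule cring.axioms)

lemma ideal_subring_onI:
  assumes "J \<subseteq> S" "0 \<in> J" "\<And>x y. x \<in> J \<Longrightarrow> y \<in> J \<Longrightarrow> x + y \<in> J"
    and mult: "\<And>r x. r \<in> S \<Longrightarrow> x \<in> J \<Longrightarrow> r * x \<in> J"
  shows "ideal J (subring_on S)"
proof (rule idealI[OF ring_subring_on])
  interpret ring "subring_on S" by (rule ring_subring_on)
  show "subgroup J (add_monoid (subring_on S))"
  proof (rule add.subgroupI)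
    fix x assume x: "x \<in> J"
    then have "- x \<in> J" using mult[OF minus_mem[OF one_mem] x] by simp
    moreover have "\<ominus>\<^bsub>subring_on S\<^esub> x = - x"
      using x assms \<open>- x \<in> J\<close> by (intro minus_equality) auto
    ultimately show "\<ominus>\<^bsub>subring_on S\<^esub> x \<in> J" by simp
  qed (use assms in auto)
  show "x \<otimes>\<^bsub>subring_on S\<^esub> a \<in> J" "a \<otimes>\<^bsub>subring_on S\<^esub> x \<in> J"
    if "a \<in> J" "x \<in> carrier (subring_on S)" for a x
    using mult[of x a] that by (simp_all add: mult.commute[of a x])
qed

lemma ideal_subring_onD:
  assumes "ideal J (subring_on S)"
  shows "J \<subseteq> S" "0 \<in> J" "x \<in> J \<Longrightarrow> y \<in> J \<Longrightarrow> x + y \<in> J" "r \<in> S \<Longrightarrow> x \<in> J \<Longrightarrow> r * x \<in> J"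
proof -
  interpret ideal J "subring_on S" by fact
  show "J \<subseteq> S" using a_subset by simp
  show "0 \<in> J" using additive_subgroup.zero_closed[OF is_additive_subgroup] by simp
  show "x \<in> J \<Longrightarrow> y \<in> J \<Longrightarrow> x + y \<in> J"
    using additive_subgroup.a_closed[OF is_additive_subgroup] by simp
  show "r \<in> S \<Longrightarrow> x \<in> J \<Longrightarrow> r * x \<in> J" using I_l_closed by simp
qed

lemma PIdl_subring_on: "PIdl\<^bsub>subring_on S\<^esub> a = {r * a | r. r \<in> S}"
  by (simp add: cgenideal_def)

end

context prime_cyclotomic
begin

section \<open>Finiteness of quotients of \<open>R\<close> and multipliers of ideals\<close>

lemma R_subset_int_span: "R \<subseteq> int_span {..<p - 1} (\<lambda>i. \<zeta> ^ i)"
proof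
  fix x assume x: "x \<in> R"
  obtain g where g: "g \<in> polys_over \<int>" "Polynomial.degree g < Polynomial.degree \<Phi>" "x = poly g \<zeta>"
    by (rule Ints.ring_adjoin_reduced[OF Phi_Ints Phi_monic degree_Phi_pos Phi_root_zeta x])
  have "\<forall>i. \<exists>n. coeff g i = of_int n" using g by (auto simp: polys_over_def elim: Ints_cases)
  then obtain a where a: "\<And>i. coeff g i = of_int (a i)" by metis
  have "x = (\<Sum>i<p - 1. of_int (a i) * \<zeta> ^ i)"
    using poly_eq_sum_lessThan[of g "p - 1" \<zeta>] g by (simp add: a degree_Phi)
  then show "x \<in> int_span {..<p - 1} (\<lambda>i. \<zeta> ^ i)" unfolding int_span_def by blast
qed

text \<open>Representatives arise by reducing the coordinates in the powers of \<zeta> modulo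
  \<open>N\<close>.\<close>

lemma finite_residues:
  fixes N :: int
  assumes N: "N > 0"
  obtains T where "finite T" "T \<subseteq> R" "\<And>r. r \<in> R \<Longrightarrow> \<exists>t\<in>T. \<exists>s\<in>R. r = t + of_int N * s"
proof -
  define v :: "(nat \<Rightarrow> int) \<Rightarrow> complex" where "v = (\<lambda>m. \<Sum>i<p - 1. of_int (m i) * \<zeta> ^ i)"
  define T where "T = v ` ({..<p - 1} \<rightarrow>\<^sub>E {0..<N})"
  have vR: "v m \<in> R" for m unfolding v_def by (intro R.mem_intros zeta_mem)
  show ?thesis
  proof
    show "finite T" unfolding T_def by (intro finite_imageI finite_PiE) auto
    show "T \<subseteq> R" unfolding T_def using vR by blast
    fix r assume "r \<in> R"
    then obtain a where a: "r = v a" using R_subset_int_span unfolding int_span_def v_def by blast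
    define m where "m = restrict (\<lambda>i. a i mod N) {..<p - 1}"
    have "v m \<in> T" unfolding T_def m_def using N by (intro imageI) (auto split: if_splits)
    moreover have "r = v m + of_int N * v (\<lambda>i. a i div N)"
      unfolding a v_def sum_distrib_left sum.distrib[symmetric]
    proof (intro sum.cong refl)
      fix i assume i: "i \<in> {..<p - 1}"
      have "(of_int (a i) :: complex) = of_int (m i + N * (a i div N))" using i by (simp add: m_def)
      then show "of_int (a i) * \<zeta> ^ i = of_int (m i) * \<zeta> ^ i + of_int N * (of_int (a i div N) * \<zeta> ^ i)"
        by (simp add: algebra_simps)
    qed
    ultimately show "\<exists>t\<in>T. \<exists>s\<in>R. r = t + of_int N * s" using vR by blast
  qed
qed

text \<open>The cofactor that turns \<open>a\<close> into a nonzero integer is an integer polynomial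
  in \<open>a\<close>, hence lies in \<open>R\<close>.\<close>

lemma ideal_contains_integer:
  assumes J: "ideal J (subring_on R)" and a: "a \<in> J" "a \<noteq> 0"
  obtains N :: int where "N > 0" "of_int N \<in> J"
proof -
  note J = R.ideal_subring_onD[OF J]
  have aR: "a \<in> R" using J a by blast
  obtain q n where q: "q \<in> polys_over \<int>" "n \<noteq> 0" "a * poly q a = of_int n"
    using algebraic_int_divides_integer[OF R_algebraic_int[OF aR] a(2)] by blast
  have "q \<in> polys_over R" using q(1) R.Ints_subset by (auto simp: polys_over_def)
  then have "poly q a * a \<in> J" using aR a by (intro J R.poly_mem)
  then have n: "of_int n \<in> J" using q by (simp add: mult.commute)
  then have "of_int (sgn n) * of_int n \<in> J" by (intro J R.of_int_mem)
  then have "of_int \<bar>n\<bar> \<in> J" by (metis abs_sgn mult.commute of_int_mult)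
  with q that[of "\<bar>n\<bar>"] show ?thesis by simp
qed

text \<open>A nonzero ideal is a finitely generated abelian group, so the determinant trick makes
  \<open>c\<close> integral, and \<open>R\<close> is integrally closed.\<close>

lemma ideal_stable_imp_mem:
  assumes J: "ideal J (subring_on R)" and a: "a \<in> J" "a \<noteq> 0"
    and c: "c \<in> K" and stable: "\<And>x. x \<in> J \<Longrightarrow> c * x \<in> J"
  shows "c \<in> R"
proof -
  note JD = R.ideal_subring_onD[OF J]
  obtain N :: int where N: "N > 0" "of_int N \<in> J" by (rule ideal_contains_integer[OF J a])
  obtain T where T: "finite T" "T \<subseteq> R" "\<And>r. r \<in> R \<Longrightarrow> \<exists>t\<in>T. \<exists>s\<in>R. r = t + of_int N * s"
    using finite_residues[OF N(1)] by blast
  \<comment> \<open>The left summand indexes generators of \<open>N R\<close>, the right one those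
    residue representatives modulo \<open>N\<close> that lie in \<open>J\<close>.\<close>
  define I where "I = {..<p - 1} <+> (T \<inter> J)"
  define g where "g = case_sum (\<lambda>i. of_int N * \<zeta> ^ i) (\<lambda>t. t)"
  have fin: "finite I" unfolding I_def using T by auto
  have gJ: "g i \<in> J" if "i \<in> I" for i
    using that JD(4)[OF R.power_mem[OF zeta_mem] N(2)] by (auto simp: I_def g_def mult.commute)
  have span: "J \<subseteq> int_span I g"
  proof
    fix x assume x: "x \<in> J"
    then obtain t s where ts: "t \<in> T" "s \<in> R" "x = t + of_int N * s" using T(3) JD(1) by blast
    have "(- s) * of_int N \<in> J" by (intro JD R.minus_mem ts N)
    from JD(3)[OF x this] have "t \<in> J" using ts by (simp add: mult.commute)
    then have "t \<in> int_span I g"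
      using ts int_span_gen[OF fin, of "Inr t" g] by (auto simp: I_def g_def)
    moreover obtain m where m: "s = (\<Sum>i<p - 1. of_int (m i) * \<zeta> ^ i)"
      using ts R_subset_int_span unfolding int_span_def by blast
    have "of_int N * s = (\<Sum>i<p - 1. of_int (m i) * g (Inl i))"
      unfolding m by (simp add: g_def sum_distrib_left mult_ac)
    then have "of_int N * s \<in> int_span I g"
      using int_span_gen[OF fin, of "Inl _" g]
      by (auto intro!: int_span_sum int_span_scale simp: I_def)
    ultimately show "x \<in> int_span I g" unfolding ts(3) by (rule int_span_add)
  qed
  have "algebraic_int c"
  proof (rule algebraic_int_if_stable[OF fin])
    show "\<exists>i\<in>I. g i \<noteq> 0"
      using p_ge_3 N by (intro bexI[of _ "Inl 0"]) (auto simp: I_def g_def)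
    show "c * g i \<in> int_span I g" if "i \<in> I" for i
      using stable[OF gJ[OF that]] span by blast
  qed
  then show ?thesis using c by (rule R_integrally_closed[rotated])
qed

text \<open>Among the multiples of \<open>c\<close> outside \<open>R\<close>, one whose denominator ideal is maximal has a prime
  denominator ideal; maximality is measured on the finitely many residues modulo a denominator
  of \<open>c\<close>.\<close>

lemma exists_multiple_with_prime_denominator:
  assumes c: "c \<in> K" "c \<notin> R"
  obtains r where "r \<in> R" "r * c \<notin> R"
    "\<And>x y. x \<in> R \<Longrightarrow> y \<in> R \<Longrightarrow> x * y * (r * c) \<in> R \<Longrightarrow> x * (r * c) \<in> R \<or> y * (r * c) \<in> R"
proof -
  obtain N :: int where N: "N > 0" "of_int N * c \<in> R"
    using c(1) by (rule ring_adjoin_Rats_clear_denominators)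
  obtain T where T: "finite T" "T \<subseteq> R" "\<And>r. r \<in> R \<Longrightarrow> \<exists>t\<in>T. \<exists>s\<in>R. r = t + of_int N * s"
    using finite_residues[OF N(1)] by blast
  define D where "D = (\<lambda>r. {t \<in> T. t * (r * c) \<in> R})"
  have fin: "finite (D r)" for r unfolding D_def using T by simp
  have "\<exists>r. (r \<in> R \<and> r * c \<notin> R) \<and> (\<forall>s. s \<in> R \<and> s * c \<notin> R \<longrightarrow> card (D s) \<le> card (D r))"
  proof (rule Lattices_Big.ex_has_greatest_nat)
    show "1 \<in> R \<and> 1 * c \<notin> R" using c R.one_mem by simp
    show "\<forall>s. s \<in> R \<and> s * c \<notin> R \<longrightarrow> card (D s) < Suc (card T)"
      using T by (auto simp: D_def less_Suc_eq_le intro!: card_mono)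
  qed
  then obtain r where r: "r \<in> R" "r * c \<notin> R"
    and max: "\<And>s. s \<in> R \<Longrightarrow> s * c \<notin> R \<Longrightarrow> card (D s) \<le> card (D r)" by blast
  show ?thesis
  proof (rule that[OF r], rule ccontr)
    fix x y assume xy: "x \<in> R" "y \<in> R" "x * y * (r * c) \<in> R"
      and not: "\<not> (x * (r * c) \<in> R \<or> y * (r * c) \<in> R)"
    have "D r \<subseteq> D (x * r)"
    proof
      fix t assume "t \<in> D r"
      then have "x * (t * (r * c)) \<in> R" "t \<in> T" using xy R.mult_mem by (auto simp: D_def)
      then show "t \<in> D (x * r)" by (simp add: D_def mult_ac)
    qed
    moreover have "card (D (x * r)) \<le> card (D r)"
      using not xy r by (intro max R.mult_mem) (auto simp: mult_ac)
    ultimately have eq: "D r = D (x * r)" using fin by (intro card_seteq)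
    \<comment> \<open>Since \<open>N * c\<close> lies in \<open>R\<close>, replacing
      \<open>y\<close> by its residue \<open>t\<close> does not affect whether it is a denominator;
      so the finite sets \<open>D\<close> see enough.\<close>
    obtain t s where ts: "t \<in> T" "s \<in> R" "y = t + of_int N * s" using T(3) xy by blast
    have "t * (x * r * c) = x * y * (r * c) - s * x * r * (of_int N * c)"
      using ts by (simp add: algebra_simps)
    also have "\<dots> \<in> R" by (intro R.diff_mem R.mult_mem ts xy r N)
    finally have "t \<in> D (x * r)" using ts by (simp add: D_def)
    then have "t * (r * c) \<in> R" unfolding eq[symmetric] by (simp add: D_def)
    then have "t * (r * c) + s * r * (of_int N * c) \<in> R" by (intro R.add_mem R.mult_mem[of "s * r"] R.mult_mem[of s] ts r N)
    then have "y * (r * c) \<in> R" using ts by (simp add: algebra_simps)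
    with not show False by blast
  qed
qed

section \<open>Nonzero prime ideals and square-free elements\<close>

lemma nonzero_prime_ideal_maximal:
  assumes P: "primeideal P (subring_on R)" and a: "a \<in> P" "a \<noteq> 0" and s: "s \<in> R" "s \<notin> P"
  obtains u x where "u \<in> R" "x \<in> P" "1 = u * s + x"
proof -
  interpret P: primeideal P "subring_on R" by fact
  note PD = R.ideal_subring_onD[OF P.is_ideal]
  obtain N :: int where N: "N > 0" "of_int N \<in> P" by (rule ideal_contains_integer[OF P.is_ideal a])
  obtain T where T: "finite T" "T \<subseteq> R" "\<And>r. r \<in> R \<Longrightarrow> \<exists>t\<in>T. \<exists>s\<in>R. r = t + of_int N * s"
    using finite_residues[OF N(1)] by blast
  \<comment> \<open>The powers of \<open>s\<close> meet only finitely many classes modulo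
    \<open>N\<close>; two that agree give an inverse of \<open>s\<close> modulo
    \<open>P\<close>.\<close>
  have "\<forall>n. \<exists>t\<in>T. \<exists>q\<in>R. s ^ n = t + of_int N * q" using T(3) R.power_mem[OF s(1)] by blast
  then obtain t q where t: "\<And>n. t n \<in> T" "\<And>n. q n \<in> R" "\<And>n. s ^ n = t n + of_int N * q n" by metis
  have "\<not> inj t"
  proof
    assume "inj t"
    moreover have "finite (range t)" using t(1) by (intro finite_subset[OF _ T(1)]) auto
    ultimately show False using finite_imageD[of t UNIV] by simp
  qed
  then obtain i j where ij: "i < j" "t i = t j"
    unfolding inj_def by (metis linorder_neqE_nat)
  have "s ^ i * (1 - s ^ (j - i)) = (q i - q j) * of_int N"
  proof -
    have "s ^ i * (1 - s ^ (j - i)) = s ^ i - s ^ j" using ij by (simp add: right_diff_distrib flip: power_add)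
    also have "\<dots> = (q i - q j) * of_int N" using t(3)[of i] t(3)[of j] ij by (simp add: algebra_simps)
    finally show ?thesis .
  qed
  also have "\<dots> \<in> P" by (intro PD R.diff_mem t N)
  finally have mem: "s ^ i * (1 - s ^ (j - i)) \<in> P" .
  have pow: "s ^ n \<notin> P" for n
  proof (induction n)
    case 0
    show ?case
    proof
      assume "s ^ 0 \<in> P"
      then have "R \<subseteq> P" using PD(4)[of _ 1] by auto
      then show False using P.I_notcarr PD(1) by auto
    qed
  next
    case (Suc n)
    then show ?case using P.I_prime[of s "s ^ n"] s R.power_mem by auto
  qed
  have "1 - s ^ (j - i) \<in> P"
    using P.I_prime[of "s ^ i" "1 - s ^ (j - i)"] mem pow s by (auto intro: R.mem_intros)
  moreover have "1 = s ^ (j - i - 1) * s + (1 - s ^ (j - i))"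
    using ij by (simp add: Suc_diff_Suc flip: power_Suc2)
  ultimately show ?thesis using that R.power_mem[OF s(1)] by blast
qed

lemma primeideal_power:
  assumes "primeideal P (subring_on R)" "x \<in> R" "x ^ n \<in> P" shows "x \<in> P"
proof -
  interpret P: primeideal P "subring_on R" by fact
  note PD = R.ideal_subring_onD[OF P.is_ideal]
  show ?thesis using assms(3)
  proof (induction n)
    case 0
    then show ?case using PD(4)[of x 1] assms(2) by simp
  next
    case (Suc n)
    then show ?case using P.I_prime[of x "x ^ n"] assms(2) R.power_mem by auto
  qed
qed

text \<open>In terms of valuations: if \<open>v(c) < 0\<close>, then
  \<open>p v(c) + i v(\<alpha>) \<ge> 0\<close> with \<open>i < p\<close> forces
  \<open>v(\<alpha>) \<ge> 2\<close>. The argument avoids prime factorisation: a multiple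
  \<open>d\<close> of \<open>c\<close> with prime denominator ideal \<open>P\<close> acts as an
  element of valuation -1 and yields a factor \<open>P\<^sup>2\<close> of
  \<open>(\<alpha>)\<close>.\<close>

lemma squarefree_imp_mem:
  assumes \<alpha>: "\<alpha> \<in> R" and sqf: "squarefree_ideal (subring_on R) (PIdl\<^bsub>subring_on R\<^esub> \<alpha>)"
    and c: "c \<in> K" "c ^ p * \<alpha> ^ i \<in> R" and i: "i < p"
  shows "c \<in> R"
proof (rule ccontr)
  assume "c \<notin> R"
  then obtain r where r: "r \<in> R" "r * c \<notin> R" and prime:
    "\<And>x y. x \<in> R \<Longrightarrow> y \<in> R \<Longrightarrow> x * y * (r * c) \<in> R \<Longrightarrow> x * (r * c) \<in> R \<or> y * (r * c) \<in> R"
    using exists_multiple_with_prime_denominator[OF c(1)] by blast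
  let ?A = "subring_on R"
  define d where "d = r * c"
  have dK: "d \<in> K" unfolding d_def using r R_subset_K c by (intro K.mult_mem) auto
  have "d ^ p * \<alpha> ^ i = r ^ p * (c ^ p * \<alpha> ^ i)" by (simp add: d_def power_mult_distrib mult_ac)
  also have "\<dots> \<in> R" by (intro R.mem_intros r c)
  finally have d: "d ^ p * \<alpha> ^ i \<in> R" .
  \<comment> \<open>The denominator ideal of \<open>d\<close>, prime by the choice of
    \<open>r\<close>.\<close>
  define P where "P = {x \<in> R. x * d \<in> R}"
  have P: "primeideal P ?A"
  proof (rule primeidealI)
    show "ideal P ?A"
      by (rule R.ideal_subring_onI) (auto simp: P_def distrib_right mult.assoc intro: R.mem_intros)
    show "cring ?A" by (rule R.cring_subring_on)
    have "1 \<notin> P" using r by (simp add: P_def d_def)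
    then show "carrier ?A \<noteq> P" using R.one_mem by auto
    fix x y assume "x \<in> carrier ?A" "y \<in> carrier ?A" "x \<otimes>\<^bsub>?A\<^esub> y \<in> P"
    then show "x \<in> P \<or> y \<in> P" using prime by (auto simp: P_def d_def)
  qed
  interpret P: primeideal P ?A by fact
  note PD = R.ideal_subring_onD[OF P.is_ideal]
  have PR: "x \<in> R" "x * d \<in> R" "d * x \<in> R" if "x \<in> P" for x using that by (auto simp: P_def mult.commute)
  obtain N :: int where N: "N > 0" "of_int N * d \<in> R"
    using dK by (rule ring_adjoin_Rats_clear_denominators)
  have NP: "of_int N \<in> P" "of_int N \<noteq> (0 :: complex)" using N R.of_int_mem by (auto simp: P_def)
  \<comment> \<open>Otherwise \<open>d\<close> would stabilise \<open>P\<close> and hence lie in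
    \<open>R\<close>. The resulting \<rho> plays the role of a uniformiser, and
    \<open>d * \<rho>\<close> that of a unit at \<open>P\<close>.\<close>
  have "\<exists>\<rho>\<in>P. d * \<rho> \<notin> P"
    using ideal_stable_imp_mem[OF P.is_ideal NP dK] r by (auto simp: d_def)
  then obtain \<rho> where \<rho>: "\<rho> \<in> P" "d * \<rho> \<notin> P" by blast
  define s where "s = d * \<rho>"
  have s: "s \<in> R" "s \<notin> P" unfolding s_def using PR(3) \<rho> by auto
  have \<rho>0: "\<rho> \<noteq> 0" using s PD(2) by (auto simp: s_def)
  \<comment> \<open>Multiplying \<open>d ^ p * \<alpha> ^ i\<close> by \<open>\<rho> ^ p\<close>
    gives \<open>s ^ p * \<alpha> ^ i\<close> in \<open>P\<close>, while \<open>s\<close> is outside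
    \<open>P\<close>.\<close>
  have \<alpha>P: "\<alpha> \<in> P"
  proof -
    have "s ^ p * \<alpha> ^ i = (d ^ p * \<alpha> ^ i * \<rho> ^ (p - 1)) * \<rho>"
      using p_ge_3 by (simp add: s_def power_mult_distrib mult_ac flip: power_Suc)
    also have "\<dots> \<in> P" by (intro PD R.mult_mem R.power_mem d \<rho> PR)
    finally have "s ^ p \<in> P \<or> \<alpha> ^ i \<in> P" using P.I_prime[of "s ^ p" "\<alpha> ^ i"] s \<alpha> R.power_mem by auto
    then show ?thesis using primeideal_power[OF P] s \<alpha> by blast
  qed
  \<comment> \<open>Second-order vanishing of \<alpha> at \<open>P\<close>: after cancelling
    \<open>\<rho> ^ i\<close> from the previous relation a factor \<rho> survives, because
    \<open>i < p\<close>.\<close>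
  have d\<alpha>P: "d * \<alpha> \<in> P"
  proof (rule ccontr)
    assume not: "d * \<alpha> \<notin> P"
    have "\<rho> ^ i * (s ^ (p - i) * (d * \<alpha>) ^ i) = s ^ (p - i) * (s * \<alpha>) ^ i"
      by (simp add: s_def power_mult_distrib mult_ac)
    also have "\<dots> = s ^ p * \<alpha> ^ i"
      using i by (simp add: power_mult_distrib flip: power_add mult.assoc)
    also have "\<dots> = \<rho> ^ p * (d ^ p * \<alpha> ^ i)" by (simp add: s_def power_mult_distrib mult_ac)
    also have "\<rho> ^ p = \<rho> ^ i * (\<rho> ^ (p - i - 1) * \<rho>)"
      unfolding power_Suc2[symmetric] power_add[symmetric] using i by simp
    finally have "s ^ (p - i) * (d * \<alpha>) ^ i = (\<rho> ^ (p - i - 1) * (d ^ p * \<alpha> ^ i)) * \<rho>"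
      using \<rho>0 by (simp add: mult_ac)
    also have "\<dots> \<in> P" by (intro PD R.mult_mem R.power_mem d \<rho> PR)
    finally have "s ^ (p - i) \<in> P \<or> (d * \<alpha>) ^ i \<in> P"
      using P.I_prime[of "s ^ (p - i)" "(d * \<alpha>) ^ i"] s PR[OF \<alpha>P] R.power_mem by auto
    then show False using primeideal_power[OF P] s PR[OF \<alpha>P] not by blast
  qed
  obtain u x where ux: "u \<in> R" "x \<in> P" "1 = u * s + x"
    by (rule nonzero_prime_ideal_maximal[OF P NP s])
  let ?PP = "P \<cdot>\<^bsub>?A\<^esub> P"
  have PP: "z \<in> R \<and> d * z \<in> R \<and> d\<^sup>2 * z \<in> R" if "z \<in> ?PP" for z
    using that
  proof (induction z rule: ideal_prod.induct)
    case (prod y z)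
    have "d * (y * z) = (d * y) * z" "d\<^sup>2 * (y * z) = (d * y) * (d * z)"
      by (simp_all add: power2_eq_square mult_ac)
    moreover have "y * z \<in> R" "(d * y) * z \<in> R" "(d * y) * (d * z) \<in> R"
      using prod PR R.mult_mem by auto
    ultimately show ?case by (simp only: subring_on_simps simp_thms)
  next
    case (sum y z)
    then show ?case by (simp add: distrib_left R.add_mem)
  qed
  \<comment> \<open>The ideal quotient of \<open>(\<alpha>)\<close> by \<open>P\<^sup>2\<close>, the
    natural candidate for the cofactor.\<close>
  define L where "L = {y \<in> R. \<forall>z\<in>?PP. \<exists>t\<in>R. y * z = t * \<alpha>}"
  have L: "ideal L ?A"
  proof (rule R.ideal_subring_onI)
    show "0 \<in> L" by (auto simp: L_def R.zero_mem intro!: bexI[of _ 0])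
    fix y z assume yz: "y \<in> L" "z \<in> L"
    show "y + z \<in> L"
      unfolding L_def
    proof (intro CollectI conjI ballI)
      show "y + z \<in> R" using yz by (auto simp: L_def R.add_mem)
      fix w assume "w \<in> ?PP"
      then obtain t t' where "t \<in> R" "t' \<in> R" "y * w = t * \<alpha>" "z * w = t' * \<alpha>"
        using yz unfolding L_def by blast
      then show "\<exists>t\<in>R. (y + z) * w = t * \<alpha>"
        by (intro bexI[of _ "t + t'"]) (auto simp: distrib_right R.add_mem)
    qed
  next
    fix a y assume ay: "a \<in> R" "y \<in> L"
    show "a * y \<in> L"
      unfolding L_def
    proof (intro CollectI conjI ballI)
      show "a * y \<in> R" using ay by (auto simp: L_def R.mult_mem)
      fix w assume "w \<in> ?PP"
      then obtain t where "t \<in> R" "y * w = t * \<alpha>" using ay unfolding L_def by blast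
      then show "\<exists>t\<in>R. a * y * w = t * \<alpha>"
        using ay by (intro bexI[of _ "a * t"]) (auto simp: mult.assoc R.mult_mem)
    qed
  qed (auto simp: L_def)
  have LI: "\<alpha> * e \<in> L" if "\<alpha> * e \<in> R" "\<And>z. z \<in> ?PP \<Longrightarrow> e * z \<in> R" for e
    unfolding L_def
  proof (intro CollectI conjI ballI that(1))
    fix z assume "z \<in> ?PP"
    then have "e * z \<in> R" by (rule that(2))
    moreover have "\<alpha> * e * z = e * z * \<alpha>" by (simp add: mult_ac)
    ultimately show "\<exists>t\<in>R. \<alpha> * e * z = t * \<alpha>" by blast
  qed
  have "\<alpha> * d\<^sup>2 \<in> R" using PR(3)[OF d\<alpha>P] by (simp add: mult_ac power2_eq_square)
  then have "\<alpha> * 1 \<in> L" "\<alpha> * d \<in> L" "\<alpha> * d\<^sup>2 \<in> L"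
    using LI[of 1] LI[of d] LI[of "d\<^sup>2"] PP PR[OF \<alpha>P] \<alpha> by auto
  then have Lmem: "\<alpha> \<in> L" "2 * (\<alpha> * d) \<in> L" "\<alpha> * d\<^sup>2 \<in> L"
    using R.ideal_subring_onD(3)[OF L, of "\<alpha> * d" "\<alpha> * d"] by simp_all
  have PPi: "ideal ?PP ?A" by (rule P.ideal_prod_is_ideal[OF P.is_ideal P.is_ideal])
  note QD = R.ideal_subring_onD[OF P.ideal_prod_is_ideal[OF PPi L]]
  have "PIdl\<^bsub>?A\<^esub> \<alpha> = ?PP \<cdot>\<^bsub>?A\<^esub> L"
  proof
    have u\<rho>: "u * \<rho> \<in> P" using ux \<rho> by (intro PD)
    have m: "y * z * w \<in> ?PP \<cdot>\<^bsub>?A\<^esub> L" if "y \<in> P" "z \<in> P" "w \<in> L" for y z w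
      using ideal_prod.prod[OF ideal_prod.prod[OF that(1,2), of ?A] that(3), of ?A] by simp
    have one: "1 = d * (u * \<rho>) + x" using ux by (simp add: s_def mult_ac)
    \<comment> \<open>Squaring the decomposition of 1 supplies two factors from \<open>P\<close> in
      every term; the remaining factors \<alpha>, \<open>2 * (\<alpha> * d)\<close> and
      \<open>\<alpha> * d\<^sup>2\<close> are in \<open>L\<close>.\<close>
    have "\<alpha> = (d * (u * \<rho>) + x)\<^sup>2 * \<alpha>" unfolding one[symmetric] by simp
    also have "\<dots> = (u * \<rho>) * (u * \<rho>) * (\<alpha> * d\<^sup>2) + (u * \<rho>) * x * (2 * (\<alpha> * d)) + x * x * \<alpha>"
      by (simp add: power2_eq_square algebra_simps)
    also have "\<dots> \<in> ?PP \<cdot>\<^bsub>?A\<^esub> L" using u\<rho> ux Lmem by (intro QD(3) m)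
    finally show "PIdl\<^bsub>?A\<^esub> \<alpha> \<subseteq> ?PP \<cdot>\<^bsub>?A\<^esub> L"
      using QD by (auto simp: R.PIdl_subring_on)
    show "?PP \<cdot>\<^bsub>?A\<^esub> L \<subseteq> PIdl\<^bsub>?A\<^esub> \<alpha>"
    proof
      fix z assume "z \<in> ?PP \<cdot>\<^bsub>?A\<^esub> L"
      then have "\<exists>t\<in>R. z = t * \<alpha>"
      proof (induction z rule: ideal_prod.induct)
        case (prod y z)
        then obtain t where "t \<in> R" "z * y = t * \<alpha>" unfolding L_def by blast
        then show ?case by (auto simp: mult.commute)
      next
        case (sum y z)
        then obtain t t' where "t \<in> R" "t' \<in> R" "y = t * \<alpha>" "z = t' * \<alpha>" by blast
        then show ?case by (intro bexI[of _ "t + t'"]) (auto simp: distrib_right R.add_mem)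
      qed
      then show "z \<in> PIdl\<^bsub>?A\<^esub> \<alpha>" by (auto simp: R.PIdl_subring_on)
    qed
  qed
  then have "ideal_dvd ?A ?PP (PIdl\<^bsub>?A\<^esub> \<alpha>)" unfolding ideal_dvd_def using L by blast
  with P sqf show False unfolding squarefree_ideal_def by blast
qed

end

section \<open>Kummer extensions of prime degree\<close>

text \<open>Irreducibility of the polynomial enters as \<open>\<beta> \<notin> R\<close>, supplied
  by \<open>irreducible_imp_no_root\<close>; the absence of proper factors over \<open>K\<close> is
  recovered from it.\<close>

locale kummer = prime_cyclotomic +
  fixes \<alpha> \<beta> :: complex
  assumes alpha_mem: "\<alpha> \<in> R" and beta_power: "\<beta> ^ p = \<alpha>" and beta_notin: "\<beta> \<notin> R"
begin

abbreviation B :: "complex set" where "B \<equiv> ring_adjoin R \<beta>"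

abbreviation E :: "complex set" where "E \<equiv> ring_adjoin K \<beta>"

definition M :: "complex poly" where "M = Polynomial.monom 1 p - [:\<alpha>:]"

sublocale B: subring_set B by (rule R.subring_set_ring_adjoin)
sublocale E: subring_set E by (rule K.subring_set_ring_adjoin)

lemma polys_over_R_subset_K: "polys_over R \<subseteq> polys_over K"
  using R_subset_K by (auto simp: polys_over_def)

lemma coeff_M: "coeff M k = (if k = p then 1 else if k = 0 then - \<alpha> else 0)"
  using p_ge_3 by (auto simp: M_def coeff_pCons split: nat.splits)

lemma degree_M: "Polynomial.degree M = p"
  by (intro antisym degree_le le_degree) (auto simp: coeff_M)

lemma M_props:
  "M \<in> polys_over R" "M \<in> polys_over K" "lead_coeff M = 1" "Polynomial.degree M > 0" "poly M \<beta> = 0"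
proof -
  show 1: "M \<in> polys_over R"
    by (auto simp: polys_over_def coeff_M R.zero_mem R.one_mem R.minus_mem alpha_mem)
  then show "M \<in> polys_over K" using polys_over_R_subset_K by blast
qed (use p_ge_3 in \<open>auto simp: degree_M coeff_M, auto simp: M_def poly_monom beta_power\<close>)

lemma poly_M: "poly M x = x ^ p - \<alpha>"
  by (simp add: M_def poly_monom)

lemma beta_algebraic_int: "algebraic_int \<beta>"
  by (rule algebraic_int_if_power[of _ p])
    (use p_ge_3 alpha_mem in \<open>auto simp: beta_power R_algebraic_int\<close>)

lemma beta_notin_K: "\<beta> \<notin> K"
  using R_integrally_closed beta_algebraic_int beta_notin by blast

lemma beta_nz: "\<beta> \<noteq> 0"
  using beta_notin R.zero_mem by auto

lemma alpha_nz: "\<alpha> \<noteq> 0"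
  using beta_nz beta_power by auto

lemma B_algebraic_int: "x \<in> B \<Longrightarrow> algebraic_int x"
  using ring_adjoin_subset[OF alg.subring_set_axioms, of R \<beta>] R_algebraic_int beta_algebraic_int
  by blast

lemma R_subset_B: "R \<subseteq> B" by (rule R.base_subset_ring_adjoin)

lemma K_subset_E: "K \<subseteq> E" by (rule K.base_subset_ring_adjoin)

lemma B_subset_E: "B \<subseteq> E"
  by (rule ring_adjoin_subset[OF E.subring_set_axioms _ K.gen_mem_ring_adjoin])
    (use R_subset_K K_subset_E in blast)

section \<open>Irreducibility of \<open>x ^ p - \<alpha>\<close> over \<open>K\<close> and
  uniqueness of coefficients\<close>

lemma beta_power_notin_K:
  assumes "0 < d" "d < p" shows "\<beta> ^ d \<notin> K"
proof
  assume dK: "\<beta> ^ d \<in> K"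
  have "coprime d p"
    using assms prime_p by (metis coprime_commute nat_dvd_not_less prime_imp_coprime_nat)
  \<comment> \<open>With \<open>x\<close> inverse to \<open>d\<close> modulo \<open>p\<close>, the
    power \<open>(\<beta> ^ d) ^ x\<close> is \<beta> times a power of \<alpha>, which would put
    \<beta> into \<open>K\<close>.\<close>
  then obtain x where x: "[d * x = Suc 0] (mod p)" using cong_solve_coprime_nat by blast
  define y where "y = d * x div p"
  have "d * x = p * y + d * x mod p" by (simp add: y_def)
  also have "d * x mod p = 1" using x p_ge_3 by (simp add: cong_def)
  finally have "(\<beta> ^ d) ^ x = \<alpha> ^ y * \<beta>"
    by (metis power_mult power_add power_one_right beta_power)
  then have "\<beta> = (\<beta> ^ d) ^ x / \<alpha> ^ y" using alpha_nz by (simp add: field_simps)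
  moreover have "\<dots> \<in> K" using dK alpha_mem R_subset_K by (intro K_divide K.power_mem[OF dK] K.power_mem[of \<alpha>]) auto
  ultimately show False using beta_notin_K by simp
qed

text \<open>The constant coefficient of a monic factor of degree \<open>d\<close> of \<open>x\<^sup>p - \<alpha>\<close> is, up to a root of
  unity, \<open>\<beta>\<^sup>d\<close>.\<close>

lemma no_monic_factor_of_M:
  assumes g: "g \<in> polys_over K" "lead_coeff g = 1" and M: "M = q * g"
    and deg: "0 < Polynomial.degree g" "Polynomial.degree g < p"
  shows False
proof -
  obtain root where root: "Polynomial.smult (lead_coeff g) (\<Prod>i<Polynomial.degree g. [:- root i, 1:]) = g"
    using complex_poly_decompose' by blast
  then have root: "g = (\<Prod>i<Polynomial.degree g. [:- root i, 1:])" using g by simp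
  let ?d = "Polynomial.degree g"
  have "\<exists>j. root i = \<zeta> ^ j * \<beta>" if "i < ?d" for i
  proof -
    have "poly (\<Prod>i<?d. [:- root i, 1:]) (root i) = 0" using that by (auto simp: poly_prod)
    then have "poly g (root i) = 0" using root by simp
    then have "root i ^ p - \<beta> ^ p = 0" using M poly_M[of "root i"] beta_power by simp
    then have "(\<Prod>j<p. root i - \<zeta> ^ j * \<beta>) = 0" unfolding prod_diff_zeta_power .
    then show ?thesis by auto
  qed
  then obtain e where e: "\<And>i. i < ?d \<Longrightarrow> root i = \<zeta> ^ e i * \<beta>" by metis
  define w where "w = (-1) ^ ?d * (\<Prod>i<?d. \<zeta> ^ e i)"
  have "coeff g 0 = poly (\<Prod>i<?d. [:- root i, 1:]) 0" using root by (simp add: poly_0_coeff_0)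
  also have "\<dots> = (\<Prod>i<?d. (-1) * \<zeta> ^ e i * \<beta>)" using e by (simp add: poly_prod)
  also have "\<dots> = w * \<beta> ^ ?d" unfolding w_def prod.distrib by simp
  finally have "\<beta> ^ ?d = coeff g 0 / w" using zeta_nz by (simp add: w_def)
  moreover have "coeff g 0 \<in> K" using g by (auto simp: polys_over_def)
  moreover have "w \<in> K" unfolding w_def using zeta_mem R_subset_K by (auto intro!: K.mem_intros)
  ultimately have "\<beta> ^ ?d \<in> K" by (simp add: K_divide)
  with beta_power_notin_K[OF deg] show False by blast
qed

text \<open>A nonzero polynomial of least degree with root \<beta> divides \<open>M\<close>, and
  \<open>M\<close> has no monic factor of intermediate degree.\<close>

lemma beta_poly_zero:
  assumes "f \<in> polys_over K" "Polynomial.degree f < p" "poly f \<beta> = 0"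
  shows "f = 0"
proof (rule ccontr)
  assume "f \<noteq> 0"
  define Q where "Q = (\<lambda>g. g \<in> polys_over K \<and> g \<noteq> 0 \<and> poly g \<beta> = 0)"
  obtain g where g: "Q g" and min: "\<And>h. Q h \<Longrightarrow> Polynomial.degree g \<le> Polynomial.degree h"
    using ex_has_least_nat[of Q f Polynomial.degree] assms \<open>f \<noteq> 0\<close> by (auto simp: Q_def)
  have g0: "lead_coeff g \<noteq> 0" using g by (simp add: Q_def)
  define h where "h = Polynomial.smult (inverse (lead_coeff g)) g"
  have h: "h \<in> polys_over K" "lead_coeff h = 1" "poly h \<beta> = 0" "Polynomial.degree h = Polynomial.degree g"
    using g g0 unfolding h_def
    by (auto simp: Q_def intro!: K.smult_mem K_inverse) (auto simp: polys_over_def)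
  have deg: "Polynomial.degree h < p"
    using min[of f] assms \<open>f \<noteq> 0\<close> h by (simp add: Q_def)
  have "Polynomial.degree h > 0"
  proof (rule ccontr)
    assume "\<not> Polynomial.degree h > 0"
    then obtain c where "h = [:c:]" by (metis degree_eq_zeroE gr0I)
    then show False using h by simp
  qed
  moreover from K.division_by_monic[OF h(1,2) this M_props(2)] obtain q r where
    qr: "q \<in> polys_over K" "r \<in> polys_over K" "M = q * h + r" "Polynomial.degree r < Polynomial.degree h" .
  moreover have "r = 0"
  proof (rule ccontr)
    assume "r \<noteq> 0"
    moreover have "poly r \<beta> = 0" using qr h M_props(5) by simp
    ultimately have "Q r" using qr by (simp add: Q_def)
    from min[OF this] show False using qr h by simp
  qed
  ultimately show False using no_monic_factor_of_M[OF h(1,2), of q] deg by simp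
qed

text \<open>As for \<zeta>, now with \<open>M\<close> as the minimal polynomial: an integral
  equation pulled back along \<open>g\<close> is divisible by \<open>M\<close> and so holds at every
  root of \<open>M\<close>.\<close>

lemma beta_conjugate_algebraic_int:
  assumes g: "g \<in> polys_over K" "algebraic_int (poly g \<beta>)"
  shows "algebraic_int (poly g (\<zeta> ^ j * \<beta>))"
proof -
  from g obtain h where h: "lead_coeff h = 1" "\<forall>i. coeff h i \<in> \<int>" "poly h (poly g \<beta>) = 0"
    by (auto elim: algebraic_int.cases)
  have "h \<in> polys_over K" using h K.Ints_subset by (auto simp: polys_over_def)
  then have "pcompose h g \<in> polys_over K" using g by (intro K.pcompose_mem)
  from K.division_by_monic[OF M_props(2-4) this] obtain q r where
    qr: "q \<in> polys_over K" "r \<in> polys_over K" "pcompose h g = q * M + r"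
      "Polynomial.degree r < Polynomial.degree M" .
  have "poly (pcompose h g) \<beta> = 0" using h by (simp add: poly_pcompose)
  then have "poly r \<beta> = 0" using qr M_props(5) by simp
  then have "r = 0" using qr by (intro beta_poly_zero) (auto simp: degree_M)
  moreover have "poly M (\<zeta> ^ j * \<beta>) = 0"
  proof -
    have "(\<zeta> ^ j) ^ p = 1" by (metis zeta_power_p power_mult mult.commute power_one)
    then show ?thesis by (simp add: poly_M power_mult_distrib beta_power)
  qed
  ultimately have "poly (pcompose h g) (\<zeta> ^ j * \<beta>) = 0" using qr by simp
  with h show ?thesis by (intro algebraic_int.intros) (simp_all add: poly_pcompose)
qed

text \<open>A reduced expression over \<open>R\<close> must agree with the given one over
  \<open>K\<close>. Hence one nonintegral coefficient certifies an element outside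
  \<open>B\<close>.\<close>

lemma coeffs_in_R_if_in_B:
  assumes g: "g \<in> polys_over K" "Polynomial.degree g < p" "poly g \<beta> \<in> B"
  shows "coeff g i \<in> R"
proof -
  obtain h where h: "h \<in> polys_over R" "Polynomial.degree h < Polynomial.degree M" "poly g \<beta> = poly h \<beta>"
    by (rule R.ring_adjoin_reduced[OF M_props(1,3,4,5) g(3)])
  interpret PK: subring_set "polys_over K" by (rule K.subring_set_polys_over)
  have "g - h = 0"
  proof (rule beta_poly_zero)
    show "g - h \<in> polys_over K" using g h polys_over_R_subset_K by (intro PK.diff_mem) auto
    show "Polynomial.degree (g - h) < p" using g h by (intro degree_diff_less) (auto simp: degree_M)
  qed (use h in simp)
  then show ?thesis using h by (simp add: polys_over_def)
qed

section \<open>Identification of \<open>E\<close> with the field generated by \<zeta> and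
  \<beta>\<close>

lemma E_clear_denominators:
  assumes "x \<in> E" obtains N :: int where "N > 0" "of_int N * x \<in> B"
proof -
  from assms obtain f where f: "f \<in> polys_over K" "x = poly f \<beta>" by (auto simp: ring_adjoin_def)
  have "\<exists>N::int. N > 0 \<and> of_int N * poly f \<beta> \<in> B" using f(1)
  proof (induction f rule: pCons_induct)
    case 0
    show ?case by (intro exI[of _ 1]) (auto intro: B.zero_mem)
  next
    case (pCons a f)
    have cf: "coeff (pCons a f) i \<in> K" for i
      using pCons.prems by (simp add: polys_over_def)
    have f: "f \<in> polys_over K" "a \<in> K"
      using cf[of "Suc _"] cf[of 0] by (simp_all add: polys_over_def)
    from pCons.IH[OF f(1)] obtain N :: int where N: "N > 0" "of_int N * poly f \<beta> \<in> B" by blast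
    obtain m :: int where m: "m > 0" "of_int m * a \<in> R"
      using f(2) by (rule ring_adjoin_Rats_clear_denominators)
    have a: "of_int m * a \<in> B" using m R_subset_B by blast
    have "of_int N * (of_int m * a) + of_int m * (\<beta> * (of_int N * poly f \<beta>)) \<in> B"
      by (rule B.add_mem B.mult_mem B.of_int_mem a N R.gen_mem_ring_adjoin)+
    then have "of_int (N * m) * poly (pCons a f) \<beta> \<in> B" by (simp add: algebra_simps)
    then show ?case using N m by (intro exI[of _ "N * m"]) auto
  qed
  with f that show ?thesis by blast
qed

lemma E_inverse: "x \<in> E \<Longrightarrow> inverse x \<in> E"
proof -
  assume x: "x \<in> E"
  then obtain N :: int where N: "N > 0" "of_int N * x \<in> B" by (rule E_clear_denominators)
  have "\<rat> \<subseteq> E" using Rats.base_subset_ring_adjoin[of \<zeta>] K_subset_E by blast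
  then show ?thesis
    by (rule inverse_mem_if_algebraic[OF E.subring_set_axioms _ x, of N])
       (use N B_algebraic_int in auto)
qed

lemma rat_adjoin_eq: "rat_adjoin {\<zeta>, \<beta>} = E"
proof
  let ?C = "ring_of_type_algebra :: complex ring"
  interpret C: field ?C by (rule field_from_type_algebra)
  have C [simp]: "carrier ?C = UNIV" "\<And>x y. x \<otimes>\<^bsub>?C\<^esub> y = x * y" "\<And>x y. x \<oplus>\<^bsub>?C\<^esub> y = x + y"
    "\<one>\<^bsub>?C\<^esub> = 1" "\<zero>\<^bsub>?C\<^esub> = 0"
    by (simp_all add: ring_of_type_algebra_def)
  have neg: "\<ominus>\<^bsub>?C\<^esub> x = - x" for x by (rule C.minus_equality) auto
  have inv: "inv\<^bsub>?C\<^esub> x = inverse x" if "x \<noteq> 0" for x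
    using that by (intro C.comm_inv_char) auto
  let ?G = "rat_adjoin {\<zeta>, \<beta>}"
  note G = generate_field.intros[where R = ?C and H = "{\<zeta>, \<beta>}", unfolded C neg, folded rat_adjoin_def]
  show "?G \<subseteq> E"
  proof
    fix x assume "x \<in> ?G"
    then show "x \<in> E" unfolding rat_adjoin_def
    proof (induction x rule: generate_field.induct)
      case (incl h)
      then show ?case
        using K.gen_mem_ring_adjoin[of \<beta>] K_subset_E R_subset_K zeta_mem by auto
    qed (auto simp: neg inv intro: E.mem_intros E_inverse)
  qed
  interpret G: subring_set ?G
  proof
    show "1 \<in> ?G" by (rule G)
    show "x * y \<in> ?G" if "x \<in> ?G" "y \<in> ?G" for x y using that by (rule G(6))
    show "x - y \<in> ?G" if "x \<in> ?G" "y \<in> ?G" for x y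
      using G(5)[OF that(1) G(3)[OF that(2)]] by simp
  qed
  have "\<rat> \<subseteq> ?G"
  proof
    fix x :: complex assume "x \<in> \<rat>"
    then obtain a b where ab: "b > 0" "x = of_int a / of_int b" by (auto elim: Rats_cases')
    have "inverse (of_int b) \<in> ?G" using G(4)[of "of_int b"] inv[of "of_int b"] G.of_int_mem ab by auto
    then show "x \<in> ?G" using ab by (auto simp: divide_inverse intro!: G.mult_mem G.of_int_mem)
  qed
  then have "K \<subseteq> ?G" by (rule ring_adjoin_subset[OF G.subring_set_axioms _ G(2)]) simp
  then show "E \<subseteq> ?G" by (rule ring_adjoin_subset[OF G.subring_set_axioms _ G(2)]) simp
qed

section \<open>An integral element outside \<open>B\<close> when \<alpha> is not square-free\<close>

lemma integral_witness_if_not_squarefree: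
  assumes "\<not> squarefree_ideal (subring_on R) (PIdl\<^bsub>subring_on R\<^esub> \<alpha>)"
  shows "\<exists>x\<in>E. algebraic_int x \<and> x \<notin> B"
proof -
  let ?A = "subring_on R"
  from assms obtain P L where P: "primeideal P ?A" and L: "ideal L ?A"
    and eq: "PIdl\<^bsub>?A\<^esub> \<alpha> = P \<cdot>\<^bsub>?A\<^esub> P \<cdot>\<^bsub>?A\<^esub> L"
    unfolding squarefree_ideal_def ideal_dvd_def by blast
  interpret P: primeideal P ?A by fact
  note PD = R.ideal_subring_onD[OF P.is_ideal] and LD = R.ideal_subring_onD[OF L]
  \<comment> \<open>Otherwise dividing \<open>P P L\<close> by \<alpha> would land in
    \<open>P\<close>; since \<alpha> lies in that product, \<open>P\<close> would contain 1.\<close>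
  have "\<exists>b\<in>P. \<exists>l\<in>L. b * l / \<alpha> \<notin> R"
  proof (rule ccontr)
    assume "\<not> ?thesis"
    then have all: "b * l / \<alpha> \<in> R" if "b \<in> P" "l \<in> L" for b l using that by blast
    have PPL: "y * l / \<alpha> \<in> P" if "y \<in> P \<cdot>\<^bsub>?A\<^esub> P" "l \<in> L" for y l
      using that
    proof (induction y rule: ideal_prod.induct)
      case (prod a b)
      then have "(b * l / \<alpha>) * a \<in> P" by (intro PD(4) all)
      then show ?case by (simp add: mult_ac)
    next
      case (sum a b)
      then show ?case by (simp add: distrib_right add_divide_distrib PD(3))
    qed
    have sub: "z / \<alpha> \<in> P" if "z \<in> P \<cdot>\<^bsub>?A\<^esub> P \<cdot>\<^bsub>?A\<^esub> L" for z
      using that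
    proof (induction z rule: ideal_prod.induct)
      case (prod y l)
      then show ?case using PPL by simp
    next
      case (sum y l)
      then show ?case by (simp add: add_divide_distrib PD(3))
    qed
    have "1 * \<alpha> \<in> PIdl\<^bsub>?A\<^esub> \<alpha>" unfolding R.PIdl_subring_on using R.one_mem by blast
    then have "1 \<in> P" using sub[of \<alpha>] alpha_nz unfolding eq by simp
    then have "R \<subseteq> P" using PD(4)[of _ 1] by auto
    then show False using P.I_notcarr PD(1) by auto
  qed
  then obtain b l where bl: "b \<in> P" "l \<in> L" "b * l / \<alpha> \<notin> R" by blast
  have blR: "b \<in> R" "l \<in> R" using bl PD(1) LD(1) by auto
  define j where "j = b * l"
  have j: "j \<in> R" "j / \<alpha> \<notin> R" unfolding j_def using bl blR by (auto intro: R.mult_mem)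
  have "b * b * l \<in> PIdl\<^bsub>?A\<^esub> \<alpha>"
    unfolding eq using ideal_prod.prod[OF ideal_prod.prod[OF bl(1) bl(1), of ?A] bl(2), of ?A] by simp
  then obtain t where t: "t \<in> R" "b * b * l = t * \<alpha>" unfolding R.PIdl_subring_on by blast
  \<comment> \<open>Already \<open>b * b * l\<close> is a multiple of \<alpha>, although
    \<open>b * l\<close> is not.\<close>
  have j2: "j\<^sup>2 = (t * l) * \<alpha>"
    using t(2) by (simp add: j_def power2_eq_square) (metis mult.assoc mult.commute)
  \<comment> \<open>This is \<open>j / \<beta>\<close>, written so that its single reduced
    coefficient is visible; its \<open>p\<close>-th power is \<open>j ^ p / \<alpha>\<close>,
    integral because \<open>p \<ge> 2\<close>.\<close>
  define x where "x = j / \<alpha> * \<beta> ^ (p - 1)"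
  have jK: "j / \<alpha> \<in> K" using j alpha_mem R_subset_K by (intro K_divide) auto
  then have "x \<in> E" unfolding x_def
    using K_subset_E by (intro E.mult_mem E.power_mem K.gen_mem_ring_adjoin) auto
  moreover have "algebraic_int x"
  proof (rule algebraic_int_if_power[of _ p])
    have "x ^ p = j ^ p / \<alpha> ^ p * (\<beta> ^ p) ^ (p - 1)"
      by (simp add: x_def power_mult_distrib power_divide mult.commute flip: power_mult)
    also have "\<dots> = j ^ p / \<alpha>"
    proof -
      have "\<alpha> ^ p = \<alpha> * \<alpha> ^ (p - 1)" using p_ge_3 by (simp flip: power_Suc)
      then show ?thesis using alpha_nz by (simp add: beta_power)
    qed
    also have "j ^ p = j ^ (p - 2) * j\<^sup>2"
      unfolding power_add[symmetric] using p_ge_3 by (intro arg_cong[of _ _ "\<lambda>n. j ^ n"]) simp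
    also have "j ^ (p - 2) * j\<^sup>2 / \<alpha> = j ^ (p - 2) * (t * l)" unfolding j2 using alpha_nz by simp
    finally have "x ^ p = j ^ (p - 2) * (t * l)" .
    then show "algebraic_int (x ^ p)"
      using R_algebraic_int[of "j ^ (p - 2) * (t * l)"] j t blR by (simp add: R.mult_mem R.power_mem)
  qed (use p_ge_3 in simp)
  moreover have "x \<notin> B"
  proof
    assume "x \<in> B"
    then have "poly (Polynomial.monom (j / \<alpha>) (p - 1)) \<beta> \<in> B" by (simp add: x_def poly_monom)
    moreover have "Polynomial.degree (Polynomial.monom (j / \<alpha>) (p - 1)) < p"
      using degree_monom_le[of "j / \<alpha>" "p - 1"] p_ge_3 by linarith
    ultimately have "coeff (Polynomial.monom (j / \<alpha>) (p - 1)) (p - 1) \<in> R"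
      by (intro coeffs_in_R_if_in_B K.monom_mem jK)
    with j show False by simp
  qed
  ultimately show ?thesis by blast
qed

section \<open>The shifted generator \<open>\<beta> - \<alpha>\<close> and the prime \<pi>\<close>

lemma shifted_power_p:
  obtains w where "w \<in> B" "(\<beta> - \<alpha>) ^ p = \<alpha> - \<alpha> ^ p + of_nat p * w"
proof -
  obtain w where w: "w \<in> B" "(\<beta> + - \<alpha>) ^ p = \<beta> ^ p + (- \<alpha>) ^ p + of_nat p * w"
    using B.freshmans_dream[OF prime_p R.gen_mem_ring_adjoin B.minus_mem, of \<alpha>] alpha_mem R_subset_B
    by blast
  then show ?thesis using that[of w] odd_p by (simp add: beta_power)
qed

lemma shifted_mem_B: "\<beta> - \<alpha> \<in> B"
  using alpha_mem R_subset_B by (intro B.diff_mem R.gen_mem_ring_adjoin) auto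

lemma degree_smult_shift_power: "Polynomial.degree (Polynomial.smult c ([:- \<alpha>, 1:] ^ (p - 1))) < p"
proof -
  have "Polynomial.degree (Polynomial.smult c ([:- \<alpha>, 1:] ^ (p - 1))) \<le> p - 1"
    using degree_smult_le[of c "[:- \<alpha>, 1:] ^ (p - 1)"] by (simp add: degree_linear_power)
  then show ?thesis using p_ge_3 by linarith
qed

lemma smult_shift_power_mem: "c \<in> K \<Longrightarrow> Polynomial.smult c ([:- \<alpha>, 1:] ^ (p - 1)) \<in> polys_over K"
proof -
  assume c: "c \<in> K"
  interpret PK: subring_set "polys_over K" by (rule K.subring_set_polys_over)
  have "[:- \<alpha>, 1:] \<in> polys_over K"
    using alpha_mem R_subset_K by (intro K.pCons_mem K.const_mem K.minus_mem K.one_mem) auto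
  then show ?thesis by (intro K.smult_mem PK.power_mem c)
qed

lemma integral_witness_if_congruent:
  assumes "(\<alpha> ^ p - \<alpha>) / \<pi>\<^sup>2 \<in> R"
  shows "\<exists>x\<in>E. algebraic_int x \<and> x \<notin> B"
proof -
  obtain w where w: "w \<in> B" "(\<beta> - \<alpha>) ^ p = \<alpha> - \<alpha> ^ p + of_nat p * w" by (rule shifted_power_p)
  \<comment> \<open>Oddness of \<open>p\<close> matters here: \<open>2 \<le> p - 1\<close>, so
    \<open>\<pi>\<^sup>2\<close> divides \<open>p\<close>.\<close>
  obtain q where q: "q \<in> R" "of_nat p = \<pi>\<^sup>2 * q" using p_in_pi_power[of 2] p_ge_3 by fastforce
  define \<epsilon> where "\<epsilon> = q * w - (\<alpha> ^ p - \<alpha>) / \<pi>\<^sup>2"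
  have \<epsilon>: "\<epsilon> \<in> B" unfolding \<epsilon>_def
    using assms w q R_subset_B by (intro B.diff_mem B.mult_mem) auto
  have pow: "(\<beta> - \<alpha>) ^ p = \<pi>\<^sup>2 * \<epsilon>" 
    unfolding w(2) q(2) \<epsilon>_def using pi_nz by (simp add: right_diff_distrib mult.assoc)
  define x where "x = (\<beta> - \<alpha>) ^ (p - 1) / \<pi>"
  define g where "g = Polynomial.smult (1 / \<pi>) ([:- \<alpha>, 1:] ^ (p - 1))"
  have gx: "poly g \<beta> = x" by (simp add: g_def x_def)
  have gK: "g \<in> polys_over K" unfolding g_def
    using pi_mem R_subset_K by (intro smult_shift_power_mem K_divide K.one_mem) auto
  then have "x \<in> E" unfolding gx[symmetric] ring_adjoin_def by blast
  moreover have "algebraic_int x"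
  proof (rule algebraic_int_if_power[of _ p])
    have "x ^ p = ((\<beta> - \<alpha>) ^ p) ^ (p - 1) / \<pi> ^ p"
      by (simp add: x_def power_divide mult.commute flip: power_mult)
    also have "\<dots> = \<pi> ^ (2 * (p - 1)) * \<epsilon> ^ (p - 1) / \<pi> ^ p"
      unfolding pow power_mult_distrib power_mult by simp
    \<comment> \<open>The numerator carries \<open>2 * (p - 1)\<close> factors \<pi>, which exceeds
      the \<open>p\<close> in the denominator by \<open>p - 2\<close>.\<close>
    also have "\<pi> ^ (2 * (p - 1)) = \<pi> ^ (p - 2) * \<pi> ^ p"
      unfolding power_add[symmetric] using p_ge_3 by (intro arg_cong[of _ _ "\<lambda>n. \<pi> ^ n"]) simp
    finally have "x ^ p = \<pi> ^ (p - 2) * \<epsilon> ^ (p - 1)" using pi_nz by simp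
    moreover have "\<dots> \<in> B" using pi_mem R_subset_B \<epsilon> by (intro B.mult_mem B.power_mem) auto
    ultimately show "algebraic_int (x ^ p)" using B_algebraic_int by simp
  qed (use p_ge_3 in simp)
  moreover have "x \<notin> B"
  proof
    assume "x \<in> B"
    then have "coeff g (p - 1) \<in> R"
      unfolding gx[symmetric]
      by (rule coeffs_in_R_if_in_B[OF gK degree_smult_shift_power[of "1 / \<pi>", folded g_def]])
    then have "1 / \<pi> \<in> R" by (simp add: g_def coeff_linear_power)
    with one_over_pi_notin show False by blast
  qed
  ultimately show ?thesis by blast
qed

text \<open>The Eisenstein argument. Expand \<open>\<pi> * \<gamma>\<close> in powers of
  \<open>b' = \<beta> - \<alpha>\<close> and treat the coefficients from the lowest up: after
  removing lower terms, a factor \<open>b' ^ (p - 1 - k)\<close> pushes the higher ones to multiples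
  of \<open>b' ^ p\<close>, which is divisible by \<pi>. What remains is one monomial, and its norm
  shows that \<pi> divides the coefficient.\<close>

lemma pi_saturated:
  assumes not_cong: "(\<alpha> ^ p - \<alpha>) / \<pi>\<^sup>2 \<notin> R"
    and \<gamma>: "\<gamma> \<in> E" "algebraic_int \<gamma>" "\<pi> * \<gamma> \<in> B"
  shows "\<gamma> \<in> B"
proof -
  define b' where "b' = \<beta> - \<alpha>"
  have b'B: "b' \<in> B" unfolding b'_def by (rule shifted_mem_B)
  obtain f where f: "f \<in> polys_over R" "Polynomial.degree f < Polynomial.degree M" "\<pi> * \<gamma> = poly f \<beta>"
    by (rule R.ring_adjoin_reduced[OF M_props(1,3,4,5) \<gamma>(3)])
  define h where "h = pcompose f [:\<alpha>, 1:]"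
  have hR: "coeff h i \<in> R" for i
    using R.pcompose_mem[OF f(1) R.pCons_mem[OF alpha_mem R.const_mem[OF R.one_mem]]]
    by (simp add: h_def polys_over_def)
  have hdeg: "Polynomial.degree h < p" using f by (simp add: h_def degree_M)
  have "poly h b' = \<pi> * \<gamma>" using f by (simp add: h_def b'_def poly_pcompose)
  then have expand: "\<pi> * \<gamma> = (\<Sum>i<p. coeff h i * b' ^ i)" using poly_eq_sum_lessThan[OF hdeg] by simp
  \<comment> \<open>The norm of \<open>\<beta> - \<alpha>\<close> divided by \<pi>; the failure of
    the congruence says exactly that \<pi> does not divide \<open>m\<close>.\<close>
  define m where "m = (\<alpha> - \<alpha> ^ p) / \<pi>"
  have m_eq: "m = - ((\<alpha> ^ p - \<alpha>) / \<pi>)" by (simp add: m_def minus_divide_left)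
  have mR: "m \<in> R" unfolding m_eq by (intro R.minus_mem power_p_minus_self_mod_pi alpha_mem)
  have m_pi: "m / \<pi> \<notin> R"
  proof
    assume "m / \<pi> \<in> R"
    then have "- (m / \<pi>) \<in> R" by (rule R.minus_mem)
    then show False using not_cong by (simp add: m_eq power2_eq_square)
  qed
  obtain w where w: "w \<in> B" "b' ^ p = \<alpha> - \<alpha> ^ p + of_nat p * w"
    unfolding b'_def by (rule shifted_power_p)
  obtain q where q: "q \<in> R" "of_nat p = \<pi> ^ 1 * q" using p_in_pi_power[of 1] p_ge_3 by fastforce
  define \<tau> where "\<tau> = m + q * w"
  have \<tau>: "\<tau> \<in> B" "b' ^ p = \<pi> * \<tau>"
    using mR w q R_subset_B pi_nz by (auto simp: \<tau>_def m_def algebra_simps intro!: B.add_mem B.mult_mem)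
  have coeff_dvd: "k < p \<Longrightarrow> coeff h k / \<pi> \<in> R" for k
  proof (induction k rule: less_induct)
    case (less k)
    let ?s = "\<lambda>A. (\<Sum>i\<in>A. coeff h i * b' ^ i)"
    define low where "low = (\<Sum>i<k. coeff h i / \<pi> * b' ^ i)"
    define high where "high = (\<Sum>i\<in>{Suc k..<p}. coeff h i * b' ^ (i - Suc k))"
    have lowB: "low \<in> B" unfolding low_def
      using less R_subset_B b'B by (intro B.sum_mem B.mult_mem B.power_mem) auto
    have highB: "high \<in> B" unfolding high_def
      using hR R_subset_B b'B by (intro B.sum_mem B.mult_mem B.power_mem) auto
    \<comment> \<open>Subtracting \<open>\<tau> * high\<close> removes all terms above index
      \<open>k\<close>, leaving \<open>coeff h k / \<pi> * b' ^ (p - 1)\<close>.\<close>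
    define \<delta> where "\<delta> = (\<gamma> - low) * b' ^ (p - 1 - k) - \<tau> * high"
    have \<delta>_alg: "algebraic_int \<delta>" unfolding \<delta>_def
      using \<gamma> lowB highB b'B \<tau> B_algebraic_int by (intro algebraic_int_mem_intros(5,6,7)) auto
    have "\<pi> * low = ?s {..<k}"
      unfolding low_def sum_distrib_left using pi_nz by (intro sum.cong) auto
    moreover have "?s {0..<Suc k} + ?s {Suc k..<p} = ?s {0..<p}"
      using less.prems by (intro sum.atLeastLessThan_concat) auto
    ultimately have "\<pi> * (\<gamma> - low) = coeff h k * b' ^ k + ?s {Suc k..<p}"
      using expand by (simp add: atLeast0LessThan algebra_simps)
    also have "?s {Suc k..<p} = b' ^ Suc k * high"
      unfolding high_def sum_distrib_left
    proof (intro sum.cong refl)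
      fix i assume "i \<in> {Suc k..<p}"
      then have "b' ^ i = b' ^ Suc k * b' ^ (i - Suc k)" unfolding power_add[symmetric] by simp
      then show "coeff h i * b' ^ i = b' ^ Suc k * (coeff h i * b' ^ (i - Suc k))" by simp
    qed
    finally have "\<pi> * (\<gamma> - low) * b' ^ (p - 1 - k) =
      (coeff h k * b' ^ k + b' ^ Suc k * high) * b' ^ (p - 1 - k)" by simp
    then have "\<pi> * ((\<gamma> - low) * b' ^ (p - 1 - k)) =
      coeff h k * (b' ^ k * b' ^ (p - 1 - k)) + (b' ^ Suc k * b' ^ (p - 1 - k)) * high"
      by (simp only: distrib_left distrib_right mult_ac)
    also have "b' ^ k * b' ^ (p - 1 - k) = b' ^ (p - 1)"
      unfolding power_add[symmetric] using less.prems by (intro arg_cong[of _ _ "\<lambda>n. b' ^ n"]) simp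
    also have "b' ^ Suc k * b' ^ (p - 1 - k) = b' ^ p"
      unfolding power_add[symmetric] using less.prems by (intro arg_cong[of _ _ "\<lambda>n. b' ^ n"]) simp
    finally have "\<pi> * \<delta> = coeff h k * b' ^ (p - 1)" using \<tau> by (simp add: \<delta>_def algebra_simps)
    then have \<delta>_eq: "\<delta> = coeff h k / \<pi> * b' ^ (p - 1)" using pi_nz by (simp add: field_simps)
    define g where "g = Polynomial.smult (coeff h k / \<pi>) ([:- \<alpha>, 1:] ^ (p - 1))"
    have gK: "g \<in> polys_over K" unfolding g_def
      using pi_mem hR R_subset_K by (intro smult_shift_power_mem K_divide) auto
    have "algebraic_int (poly g \<beta>)" using \<delta>_alg by (simp add: \<delta>_eq g_def b'_def)
    then have conj: "algebraic_int (poly g (\<zeta> ^ j * \<beta>))" for j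
      by (rule beta_conjugate_algebraic_int[OF gK])
    text \<open>The norm of \<open>\<delta>\<close> from \<open>E\<close> to \<open>K\<close>.\<close>
    have "(\<Prod>j<p. \<zeta> ^ j * \<beta> - \<alpha>) = (\<Prod>j<p. - 1 * (\<alpha> - \<zeta> ^ j * \<beta>))"
      by (intro prod.cong) auto
    also have "\<dots> = (- 1) ^ p * (\<alpha> ^ p - \<beta> ^ p)"
      unfolding prod.distrib prod_diff_zeta_power by simp
    also have "\<dots> = \<pi> * m" using odd_p pi_nz by (simp add: beta_power m_def)
    finally have norm: "(\<Prod>j<p. \<zeta> ^ j * \<beta> - \<alpha>) = \<pi> * m" .
    have "(\<Prod>j<p. poly g (\<zeta> ^ j * \<beta>)) = (\<Prod>j<p. coeff h k / \<pi> * (\<zeta> ^ j * \<beta> - \<alpha>) ^ (p - 1))"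
      by (simp add: g_def)
    also have "\<dots> = (coeff h k / \<pi>) ^ p * (\<pi> * m) ^ (p - 1)"
      unfolding prod.distrib prod_power_distrib[symmetric] norm by simp
    also have "\<dots> = coeff h k ^ p * m ^ (p - 1) / \<pi>"
    proof -
      have "\<pi> ^ p = \<pi> * \<pi> ^ (p - 1)" using p_ge_3 by (simp flip: power_Suc)
      then show ?thesis using pi_nz by (simp add: power_divide power_mult_distrib)
    qed
    finally have "algebraic_int (coeff h k ^ p * m ^ (p - 1) / \<pi>)"
      using alg.prod_mem[of "{..<p}" "\<lambda>j. poly g (\<zeta> ^ j * \<beta>)"] conj by simp
    moreover have "coeff h k ^ p * m ^ (p - 1) / \<pi> \<in> K"
      using hR mR pi_mem R_subset_K by (intro K_divide K.mult_mem K.power_mem) auto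
    ultimately have "coeff h k ^ p * m ^ (p - 1) / \<pi> \<in> R" by (rule R_integrally_closed[rotated])
    then have "coeff h k ^ p / \<pi> \<in> R \<or> m ^ (p - 1) / \<pi> \<in> R"
      by (rule pi_prime[OF R.power_mem[OF hR] R.power_mem[OF mR]])
    then show ?case using pi_prime_power[OF hR] pi_prime_power[OF mR] m_pi by blast
  qed
  have "\<gamma> = (\<Sum>i<p. coeff h i / \<pi> * b' ^ i)"
  proof -
    have "\<pi> * (\<Sum>i<p. coeff h i / \<pi> * b' ^ i) = \<pi> * \<gamma>"
      unfolding expand sum_distrib_left using pi_nz by (intro sum.cong) auto
    then show ?thesis using pi_nz by simp
  qed
  also have "\<dots> \<in> B" using coeff_dvd R_subset_B b'B by (intro B.sum_mem B.mult_mem B.power_mem) auto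
  finally show ?thesis .
qed

section \<open>Bounding denominators, and the ring of integers of \<open>E\<close>\<close>

lemma p_times_integral_mem:
  assumes sqf: "squarefree_ideal (subring_on R) (PIdl\<^bsub>subring_on R\<^esub> \<alpha>)"
    and \<gamma>: "\<gamma> \<in> E" "algebraic_int \<gamma>"
  shows "of_nat p * \<gamma> \<in> B"
proof -
  obtain g where g: "g \<in> polys_over K" "Polynomial.degree g < Polynomial.degree M" "\<gamma> = poly g \<beta>"
    by (rule K.ring_adjoin_reduced[OF M_props(2-5) \<gamma>(1)])
  have deg: "Polynomial.degree g < p" using g by (simp add: degree_M)
  have conj: "algebraic_int (poly g (\<zeta> ^ j * \<beta>))" for j
    using g \<gamma> by (intro beta_conjugate_algebraic_int) auto
  have gR: "of_nat p * coeff g k \<in> R" if k: "k < p" for k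
  proof (rule squarefree_imp_mem[OF alpha_mem sqf _ _ k])
    let ?c = "of_nat p * coeff g k"
    show cK: "?c \<in> K" using g by (intro K.mult_mem K.of_nat_mem) (auto simp: polys_over_def)
    have "algebraic_int (\<Sum>j<p. \<zeta> ^ (j * (p - k)) * poly g (\<zeta> ^ j * \<beta>))"
      using conj R_algebraic_int[OF R.power_mem[OF zeta_mem]] by (intro algebraic_int_mem_intros(6,8))
    \<comment> \<open>The weighted sum of conjugates equals \<open>?c * \<beta> ^ k\<close>. Its
      \<open>p\<close>-th power lies in \<open>K\<close>, where integral elements belong to
      \<open>R\<close>.\<close>
    then have "algebraic_int ((?c * \<beta> ^ k) ^ p)"
      unfolding coeff_from_conjugates[OF deg k] by (rule algebraic_int_mem_intros(7))
    also have "(?c * \<beta> ^ k) ^ p = ?c ^ p * \<alpha> ^ k"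
      by (simp add: power_mult_distrib mult.commute flip: beta_power power_mult)
    finally show "?c ^ p * \<alpha> ^ k \<in> R"
      using cK alpha_mem R_subset_K by (intro R_integrally_closed K.mult_mem K.power_mem[OF cK] K.power_mem[of \<alpha>]) auto
  qed
  have "of_nat p * \<gamma> = (\<Sum>k<p. of_nat p * coeff g k * \<beta> ^ k)"
    unfolding g(3) poly_eq_sum_lessThan[OF deg] by (simp add: sum_distrib_left mult.assoc)
  also have "\<dots> \<in> B"
    using gR R_subset_B by (intro B.sum_mem B.mult_mem[of _ "\<beta> ^ _"] B.power_mem R.gen_mem_ring_adjoin) auto
  finally show ?thesis .
qed

text \<open>As \<open>p\<close> is a unit times \<open>\<pi> ^ (p - 1)\<close>, the bound on
  denominators puts a power of \<pi> times \<gamma> into \<open>B\<close>;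
  \<open>pi_saturated\<close> then removes one factor at a time.\<close>

lemma integral_mem_B:
  assumes sqf: "squarefree_ideal (subring_on R) (PIdl\<^bsub>subring_on R\<^esub> \<alpha>)"
    and not_cong: "(\<alpha> ^ p - \<alpha>) / \<pi>\<^sup>2 \<notin> R"
    and \<gamma>: "\<gamma> \<in> E" "algebraic_int \<gamma>"
  shows "\<gamma> \<in> B"
proof -
  have piE: "\<pi> \<in> E" using pi_mem R_subset_B B_subset_E by blast
  have descend: "\<pi> ^ n * \<gamma> \<in> B \<Longrightarrow> \<gamma> \<in> B" for n
  proof (induction n)
    case (Suc n)
    have "\<pi> ^ n * \<gamma> \<in> B"
    proof (rule pi_saturated[OF not_cong])
      show "\<pi> ^ n * \<gamma> \<in> E" using piE \<gamma> by (intro E.mult_mem E.power_mem)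
      show "algebraic_int (\<pi> ^ n * \<gamma>)"
        using \<gamma> R_algebraic_int[OF pi_mem] by (intro algebraic_int_mem_intros(6,7))
      show "\<pi> * (\<pi> ^ n * \<gamma>) \<in> B" using Suc.prems by (simp add: mult.assoc)
    qed
    then show ?case by (rule Suc.IH)
  qed simp
  obtain u v where uv: "u \<in> R" "v \<in> R" "u * v = 1" "of_nat p = u * \<pi> ^ (p - 1)"
    by (rule p_eq_unit_times_pi_power)
  have "v * (of_nat p * \<gamma>) \<in> B"
    using uv(2) R_subset_B by (intro B.mult_mem[of v] p_times_integral_mem sqf \<gamma>) auto
  also have "v * (of_nat p * \<gamma>) = (u * v) * (\<pi> ^ (p - 1) * \<gamma>)" unfolding uv(4) by (simp add: mult_ac)
  finally show ?thesis unfolding uv(3) using descend[of "p - 1"] by simp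
qed

lemma ring_of_integers_eq_B_iff:
  "ring_of_integers (rat_adjoin {\<zeta>, \<beta>}) = B \<longleftrightarrow>
    squarefree_ideal (subring_on R) (PIdl\<^bsub>subring_on R\<^esub> \<alpha>) \<and> (\<alpha> ^ p - \<alpha>) / \<pi>\<^sup>2 \<notin> R"
proof -
  have "ring_of_integers (rat_adjoin {\<zeta>, \<beta>}) = B \<longleftrightarrow> (\<forall>x\<in>E. algebraic_int x \<longrightarrow> x \<in> B)"
    unfolding ring_of_integers_def rat_adjoin_eq using B_subset_E B_algebraic_int by blast
  then show ?thesis
    using integral_witness_if_not_squarefree integral_witness_if_congruent integral_mem_B by blast
qed

end

section \<open>Translating the ideal congruence and irreducibility into statements on
  elements\<close>

lemma (in prime_cyclotomic) cong_mod_pi_squared_iff: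
  fixes a b :: complex
  defines "\<pp> \<equiv> PIdl\<^bsub>subring_on R\<^esub> (1 - \<zeta>)"
  shows "cong_mod_ideal a b (\<pp> \<cdot>\<^bsub>subring_on R\<^esub> \<pp>) \<longleftrightarrow> (a - b) / \<pi>\<^sup>2 \<in> R"
proof -
  have pp: "\<pp> = {r * \<pi> | r. r \<in> R}" unfolding \<pp>_def R.PIdl_subring_on \<pi>_def ..
  have "x / \<pi>\<^sup>2 \<in> R" if "x \<in> \<pp> \<cdot>\<^bsub>subring_on R\<^esub> \<pp>" for x
    using that
  proof (induction x rule: ideal_prod.induct)
    case (prod x y)
    then obtain r s where rs: "r \<in> R" "s \<in> R" "x = r * \<pi>" "y = s * \<pi>" unfolding pp by blast
    then have "x * y / \<pi>\<^sup>2 = r * s" using pi_nz by (simp add: power2_eq_square)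
    then show ?case using rs by (simp add: R.mult_mem)
  next
    case (sum x y)
    then show ?case by (simp add: add_divide_distrib R.add_mem)
  qed
  moreover have "x \<in> \<pp> \<cdot>\<^bsub>subring_on R\<^esub> \<pp>" if x: "x / \<pi>\<^sup>2 \<in> R" for x
  proof -
    \<comment> \<open>A multiple of \<open>\<pi>\<^sup>2\<close> is a single product of two
      multiples of \<pi>, so no sums are needed.\<close>
    have "(x / \<pi>\<^sup>2 * \<pi>) \<otimes>\<^bsub>subring_on R\<^esub> (1 * \<pi>) \<in> \<pp> \<cdot>\<^bsub>subring_on R\<^esub> \<pp>"
      using x R.one_mem unfolding pp by (intro ideal_prod.prod) blast+
    then show ?thesis using pi_nz by (simp add: power2_eq_square)
  qed
  ultimately show ?thesis unfolding cong_mod_ideal_def by blast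
qed

text \<open>A root in \<open>S\<close> splits off the monic linear factor \<open>X - a\<close>
  inside \<open>S[x]\<close>; comparing degrees, it is a proper factor and not a unit.\<close>

lemma irreducible_imp_no_root:
  fixes S :: "'a::idom set"
  assumes "subring_set S" and irr: "ring_irreducible\<^bsub>subring_on (polys_over S)\<^esub> f"
    and f: "f \<in> polys_over S" "Polynomial.degree f > 1" "poly f a = 0"
  shows "a \<notin> S"
proof
  interpret subring_set S by fact
  assume a: "a \<in> S"
  let ?P = "subring_on (polys_over S)"
  define l where "l = [:- a, 1:]"
  have l: "l \<in> polys_over S" unfolding l_def by (intro pCons_mem const_mem minus_mem a one_mem)
  have ldeg: "Polynomial.degree l = 1" "lead_coeff l = 1" "poly l a = 0" by (simp_all add: l_def)
  obtain q r where qr: "q \<in> polys_over S" "r \<in> polys_over S" "f = q * l + r"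
    "Polynomial.degree r < Polynomial.degree l"
    by (rule division_by_monic[OF l ldeg(2) _ f(1)]) (simp add: ldeg)
  then obtain c where c: "r = [:c:]" using ldeg by (metis degree_eq_zeroE less_one)
  have "c = 0" using f(3) qr(3) c ldeg by simp
  then have fq: "f = l * q" using qr c by (simp add: mult.commute)
  have degree_mult: "Polynomial.degree (x * y) = Polynomial.degree x + Polynomial.degree y"
    if "x * y \<noteq> 0" for x y :: "'a poly" using that by (intro degree_mult_eq) auto
  have "properfactor ?P l f"
    unfolding properfactor_def factor_def
  proof (intro conjI notI)
    show "\<exists>c\<in>carrier ?P. f = l \<otimes>\<^bsub>?P\<^esub> c" using fq qr by auto
    assume "\<exists>c\<in>carrier ?P. l = f \<otimes>\<^bsub>?P\<^esub> c"
    then obtain x where "l = f * x" by auto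
    moreover have "l \<noteq> 0" using ldeg(2) by auto
    ultimately have "Polynomial.degree l = Polynomial.degree f + Polynomial.degree x"
      using degree_mult[of f x] by simp
    with ldeg f(2) show False by simp
  qed
  then have "l \<in> Units ?P" using irr l unfolding ring_irreducible_def Divisibility.irreducible_def by simp
  then obtain x where "l * x = 1" unfolding Units_def by auto
  with degree_mult[of l x] ldeg(1) show False by simp
qed

theorem theorem1p1:
  fixes p :: nat and \<zeta> \<alpha> \<beta> :: complex
  defines "R \<equiv> subring_on (cyclotomic_ring \<zeta>)"
  defines "\<pp> \<equiv> PIdl\<^bsub>R\<^esub> (1 - \<zeta>)"
  assumes "Factorial_Ring.prime p" and "odd p"
    and "primitive_root_of_unity p \<zeta>"
    and "\<alpha> \<in> cyclotomic_ring \<zeta>"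
    and "ring_irreducible\<^bsub>subring_on (polys_over (cyclotomic_ring \<zeta>))\<^esub>
           (Polynomial.monom 1 p - [:\<alpha>:])"
    and "poly (Polynomial.monom 1 p - [:\<alpha>:]) \<beta> = 0"
  shows "ring_of_integers (rat_adjoin {\<zeta>, \<beta>}) = ring_adjoin (cyclotomic_ring \<zeta>) \<beta> \<longleftrightarrow>
         squarefree_ideal R (PIdl\<^bsub>R\<^esub> \<alpha>) \<and>
         \<not> cong_mod_ideal (\<alpha> ^ p) \<alpha> (\<pp> \<cdot>\<^bsub>R\<^esub> \<pp>)"
proof -
  let ?f = "Polynomial.monom 1 p - [:\<alpha>:]"
  note p = assms(3,4,5) and \<alpha> = assms(6) and irr = assms(7) and root = assms(8)
  interpret C: prime_cyclotomic p \<zeta> using p by unfold_locales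
  have f: "?f \<in> polys_over (cyclotomic_ring \<zeta>)"
    by (intro subring_set.diff_mem[OF C.R.subring_set_polys_over] C.R.monom_mem C.R.const_mem
      C.R.one_mem \<alpha>)
  have "coeff ?f p = 1" using C.p_ge_3 by (auto simp: coeff_pCons split: nat.splits)
  then have "p \<le> Polynomial.degree ?f" by (intro le_degree) simp
  then have "1 < Polynomial.degree ?f" using C.p_ge_3 by linarith
  then have "\<beta> \<notin> cyclotomic_ring \<zeta>"
    by (rule irreducible_imp_no_root[OF C.R.subring_set_axioms irr f _ root])
  moreover have "\<beta> ^ p = \<alpha>" using root by (simp add: poly_monom)
  ultimately interpret kummer p \<zeta> \<alpha> \<beta> using \<alpha> by unfold_locales
  show ?thesis
    unfolding R_def \<pp>_def C.cong_mod_pi_squared_iff by (rule ring_of_integers_eq_B_iff)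
qed

end
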